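(* Let $\lambda\ge 0$ and $\gamma\in(0,2)$ be constants with $\gamma\ge \lambda^2/3$. Consider the planar dynamical system $$\Sigma_\varphi' = -(2-q)\Sigma_\varphi+\sqrt{\tfrac32}\,\lambda\,\Omega_V,\qquad \Omega_{\mathrm{pf}}'=\big[2(1+q)-3\gamma\big]\Omega_{\mathrm{pf}},$$ where $\Omega_V = 1-\Sigma_\varphi^2-\Omega_{\mathrm{pf}}$ and $q=-1+3\Sigma_\varphi^2+\tfrac32\gamma\,\Omega_{\mathrm{pf}}$, on the state space $\{(\Sigma_\varphi,\Omega_{\mathrm{pf}}):\Omega_V\ge 0,\ \Omega_{\mathrm{pf}}\ge 0\}$. Let $\mathrm{K}_\pm=(\pm1,0)$, $\mathrm{FL}=(0,1)$ and $\mathrm{P}=(\lambda/\sqrt6,0)$ (this point is called $\mathrm{dS}$ when $\lambda=0$, and it coincides with the point $\mathrm{S}=\big(\sqrt{3/2}\,\gamma/\lambda,\,1-3\gamma/\lambda^2\big)$ when $\gamma=\lambda^2/3$). Then: (i) every interior orbit converges to $\mathrm{P}$ as $N\to+\infty$ (i.e. its $\omega$-limit set is $\{\mathrm{P}\}$); (ii) exactly one interior orbit has $\alpha$-limit set $\{\mathrm{FL}\}$; (iii) every other interior orbit has $\alpha$-limit set $\{\mathrm{K}_-\}$ or $\{\mathrm{K}_+\}$, and each of $\mathrm{K}_-$, $\mathrm{K}_+$ is the $\alpha$-limit of a 1-parameter family of interior orbits.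
   Context: The system arises from a spatially flat FLRW cosmology with a minimally coupled scalar field $\varphi$ with potential $V=V_0e^{-\lambda\varphi}$ and a perfect fluid with $p_{\mathrm{pf}}=(\gamma-1)\rho_{\mathrm{pf}}$; $\Sigma_\varphi=\dot\varphi/(\sqrt6 H)$, $\Omega_V=V/(3H^2)$, $\Omega_{\mathrm{pf}}=\rho_{\mathrm{pf}}/(3H^2)$, and ${}'$ denotes derivative with respect to the $e$-fold time $N=\ln(a/a_0)$. An interior orbit is an orbit with $\Omega_V>0$ and $\Omega_{\mathrm{pf}}>0$. "Originates from" a fixed point means the orbit tends to it as $N\to-\infty$. *)

theory Defs
  imports "HOL-Analysis.Analysis"
begin

text \<open>State (x, y) = (Sigma_phi, Omega_pf); time is the e-fold time N.\<close>

definition OmegaV :: "real \<times> real \<Rightarrow> real" where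
  "OmegaV p = 1 - (fst p)\<^sup>2 - snd p"

definition qdec :: "real \<Rightarrow> real \<times> real \<Rightarrow> real" where
  "qdec gam p = -1 + 3 * (fst p)\<^sup>2 + 3/2 * gam * snd p"

definition vf :: "real \<Rightarrow> real \<Rightarrow> real \<times> real \<Rightarrow> real \<times> real" where
  "vf lam gam p =
     (- (2 - qdec gam p) * fst p + sqrt (3/2) * lam * OmegaV p,
      (2 * (1 + qdec gam p) - 3 * gam) * snd p)"

definition state_space :: "(real \<times> real) set" where
  "state_space = {p. OmegaV p \<ge> 0 \<and> snd p \<ge> 0}"

definition interior_set :: "(real \<times> real) set" where
  "interior_set = {p. OmegaV p > 0 \<and> snd p > 0}"

definition interior_solution :: "real \<Rightarrow> real \<Rightarrow> (real \<Rightarrow> real \<times> real) \<Rightarrow> bool" where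
  "interior_solution lam gam u \<longleftrightarrow>
     (\<forall>t. (u has_vector_derivative vf lam gam (u t)) (at t)) \<and> (\<forall>t. u t \<in> interior_set)"

definition omega_limit :: "(real \<Rightarrow> real \<times> real) \<Rightarrow> (real \<times> real) set" where
  "omega_limit u = {p. \<exists>s :: nat \<Rightarrow> real. filterlim s at_top sequentially \<and> (\<lambda>n. u (s n)) \<longlonglongrightarrow> p}"

definition alpha_limit :: "(real \<Rightarrow> real \<times> real) \<Rightarrow> (real \<times> real) set" where
  "alpha_limit u = {p. \<exists>s :: nat \<Rightarrow> real. filterlim s at_bot sequentially \<and> (\<lambda>n. u (s n)) \<longlonglongrightarrow> p}"

definition Kp :: "real \<times> real" where "Kp = (1, 0)"
definition Km :: "real \<times> real" where "Km = (-1, 0)"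
definition FL :: "real \<times> real" where "FL = (0, 1)"
definition Ppt :: "real \<Rightarrow> real \<times> real" where "Ppt lam = (lam / sqrt 6, 0)"

definition one_param_family_from :: "real \<Rightarrow> real \<Rightarrow> real \<times> real \<Rightarrow> bool" where
  "one_param_family_from lam gam K \<longleftrightarrow>
     (\<exists>c :: real \<Rightarrow> real \<times> real.
        continuous_on {0<..<1} c \<and> inj_on c {0<..<1} \<and> c ` {0<..<1} \<subseteq> interior_set \<and>
        (\<forall>u. interior_solution lam gam u \<and> alpha_limit u = {K} \<longrightarrow>
              (\<exists>!s. s \<in> {0<..<1} \<and> c s \<in> range u)) \<and>
        (\<forall>s\<in>{0<..<1}. \<forall>u. interior_solution lam gam u \<and> c s \<in> range u \<longrightarrow> alpha_limit u = {K}))"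

end

theory Submission
  imports Defs
begin

text \<open>Put \<open>a = \<lambda> / sqrt 6\<close>, \<open>g = \<gamma> / 2\<close>, so that \<open>a\<^sup>2 \<le> g < 1\<close>, and write \<open>x, y, V\<close> for
  \<open>\<Sigma>\<^sub>\<phi>, \<Omega>\<^sub>p\<^sub>f, \<Omega>\<^sub>V\<close>. Then \<open>x' = 3 ((a - x) V - (1 - g) x y)\<close>, and \<open>M = V / (1 - a x)\<^sup>2\<close> is increasing with
  \<open>(ln M)' = 6 ((x - a)\<^sup>2 + (g - a\<^sup>2) y) / (1 - a x)\<close>. By Barbalat's lemma an orbit tends to \<open>P\<close> in the
  future, while in the past \<open>M\<close> must decrease to 0, i.e. \<open>V \<longlongrightarrow> 0\<close>. Since \<open>x' > 0\<close> for \<open>x < 0\<close> and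
  \<open>x' < 0\<close> for \<open>x > a\<close>, going backwards an orbit that meets \<open>x < 0\<close> tends to \<open>K\<^sub>-\<close>, one that meets
  \<open>x > a\<close> tends to \<open>K\<^sub>+\<close>, and one that stays in \<open>0 \<le> x \<le> a\<close> tends to \<open>FL\<close>. The lines \<open>x = - 1/2\<close> and
  \<open>x = (1 + a)/2\<close> are therefore transversals for the orbits from \<open>K\<^sub>-\<close> and \<open>K\<^sub>+\<close>. An orbit from
  \<open>FL\<close> is obtained by shooting, and two of them coincide by a monotonicity argument in the
  variable \<open>ln (V / y)\<close>.\<close>

section \<open>Globally Lipschitz differential equations\<close>

lemma has_vector_derivative_reflect:
  assumes "(f has_vector_derivative f') (at (- t))"
  shows "((\<lambda>s. f (- s)) has_vector_derivative - f') (at t)"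
proof -
  have "(uminus has_vector_derivative - 1) (at t)"
    by (auto intro!: derivative_eq_intros)
  from vector_diff_chain_at[OF this assms] show ?thesis by (simp add: o_def)
qed

text \<open>Integrating the weight gains the factor \<open>1 / (2 * L)\<close>: for
  \<open>t > 0\<close> this is the mean value inequality against the antiderivative of
  \<open>C * exp (2 * L * s)\<close>, and reflection covers \<open>t < 0\<close>. The gain is what
  makes the Picard map contract by \<open>1 / 2\<close>.\<close>

lemma norm_increment_le_exp:
  fixes K k :: "real \<Rightarrow> 'a::real_normed_vector"
  assumes "L > 0"
    and K: "\<And>t. (K has_vector_derivative k t) (at t)"
    and k: "\<And>t. norm (k t) \<le> C * exp (2 * L * \<bar>t\<bar>)"
  shows "norm (K t - K 0) \<le> C / (2 * L) * exp (2 * L * \<bar>t\<bar>)"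
proof -
  have C: "C \<ge> 0"
    using order_trans[OF norm_ge_zero k[of 0]] by simp
  have pos: "norm (H t - H 0) \<le> C / (2 * L) * exp (2 * L * t)"
    if "t > 0" and H: "\<And>s. (H has_vector_derivative h s) (at s)"
      and h: "\<And>s. norm (h s) \<le> C * exp (2 * L * \<bar>s\<bar>)"
    for H h :: "real \<Rightarrow> 'a" and t
  proof -
    have "norm (H t - H 0) \<le> C / (2 * L) * exp (2 * L * t) - C / (2 * L) * exp (2 * L * 0)"
    proof (rule differentiable_bound_general[where f' = h and \<phi>' = "\<lambda>s. C * exp (2 * L * s)"])
      show "continuous_on {0..t} H"
        using H by (meson continuous_at_imp_continuous_on has_vector_derivative_continuous)
      show "((\<lambda>s. C / (2 * L) * exp (2 * L * s)) has_vector_derivative C * exp (2 * L * x)) (at x)"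
        for x
        unfolding has_real_derivative_iff_has_vector_derivative[symmetric]
        using \<open>L > 0\<close> by (auto intro!: derivative_eq_intros simp: field_simps)
      show "norm (h x) \<le> C * exp (2 * L * x)" if "0 < x" "x < t" for x
        using h[of x] that by simp
    qed (use \<open>t > 0\<close> \<open>L > 0\<close> H in \<open>auto intro!: continuous_intros\<close>)
    also have "\<dots> \<le> C / (2 * L) * exp (2 * L * t)"
      using C \<open>L > 0\<close> by simp
    finally show ?thesis .
  qed
  consider "t > 0" | "t = 0" | "t < 0" by linarith
  then show ?thesis
  proof cases
    case 1
    then show ?thesis using pos[OF 1 K k] by simp
  next
    case 2
    then show ?thesis using C \<open>L > 0\<close> by simp
  next
    case 3
    have "((\<lambda>s. K (- s)) has_vector_derivative - k (- s)) (at s)" for s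
      by (rule has_vector_derivative_reflect[OF K])
    from pos[of "- t", OF _ this] k[of "- s" for s] 3 show ?thesis by simp
  qed
qed

text \<open>Existence: Picard iteration contracts in the weighted norm
  \<open>sup\<^sub>t exp (- 2 L \<bar>t\<bar>) \<parallel>u t - u\<^sub>0\<parallel>\<close> on all of \<open>\<real>\<close>.\<close>

lemma global_solution_exists:
  fixes f :: "'a::euclidean_space \<Rightarrow> 'a"
  assumes lip: "L-lipschitz_on UNIV f" and "L > 0"
  shows "\<exists>u. u 0 = u0 \<and> (\<forall>t. (u has_vector_derivative f (u t)) (at t))"
proof -
  define e where "e t = exp (2 * L * \<bar>t\<bar>)" for t :: real
  have e_pos: "e t > 0" for t unfolding e_def by simp
  have e_ge1: "e t \<ge> 1" for t unfolding e_def using \<open>L > 0\<close> by simp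
  have e_cont: "continuous_on UNIV e" unfolding e_def by (intro continuous_intros)
  \<comment> \<open>Here \<open>v\<close> stands for the weighted increment
    \<open>(u - u0) / e\<close>, so the complete space of bounded continuous functions can serve as
    domain; \<open>k v\<close> is the Picard integrand in this variable and \<open>G v\<close> below
    is the rescaled Picard map.\<close>
  define k :: "(real \<Rightarrow>\<^sub>C 'a) \<Rightarrow> real \<Rightarrow> 'a"
    where "k v s = f (u0 + e s *\<^sub>R apply_bcontfun v s)" for v s
  have f_cont: "continuous_on UNIV f"
    using lip by (rule lipschitz_on_continuous_on)
  have "continuous_on UNIV (k v)" for v
    unfolding k_def
    by (rule continuous_on_compose2[OF f_cont]) (auto intro!: continuous_intros e_cont)
  then have "isCont (k v) s" for v s
    by (simp add: continuous_on_eq_continuous_at)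
  then have "\<exists>K. \<forall>s. (K has_vector_derivative k v s) (at s)" for v
    using einterval_antiderivative[of "-\<infinity>" \<infinity> "k v"] by auto
  then obtain K where K: "\<And>v s. (K v has_vector_derivative k v s) (at s)"
    by metis
  have k_diff: "norm (k v s - k w s) \<le> (L * dist v w) * exp (2 * L * \<bar>s\<bar>)" for v w s
  proof -
    have "norm (k v s - k w s) \<le> L * dist (u0 + e s *\<^sub>R apply_bcontfun v s) (u0 + e s *\<^sub>R apply_bcontfun w s)"
      unfolding k_def dist_norm[symmetric] by (rule lipschitz_onD[OF lip]) auto
    also have "\<dots> = L * (e s * dist (apply_bcontfun v s) (apply_bcontfun w s))"
      using e_pos[of s] by (simp add: dist_norm flip: scaleR_right_diff_distrib)
    also have "\<dots> \<le> L * (e s * dist v w)"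
      using \<open>L > 0\<close> e_pos[of s] by (intro mult_left_mono dist_bounded) auto
    finally show ?thesis by (simp add: e_def algebra_simps)
  qed
  have k_bound: "norm (k v s) \<le> (L * dist v 0 + norm (f u0)) * exp (2 * L * \<bar>s\<bar>)" for v s
  proof -
    have "norm (k v s) \<le> norm (k v s - k 0 s) + norm (k 0 s)"
      by (metis diff_add_cancel norm_triangle_ineq)
    also have "\<dots> \<le> (L * dist v 0) * exp (2 * L * \<bar>s\<bar>) + norm (f u0) * 1"
      using k_diff[of v s 0] by (simp add: k_def)
    also have "\<dots> \<le> (L * dist v 0) * exp (2 * L * \<bar>s\<bar>) + norm (f u0) * exp (2 * L * \<bar>s\<bar>)"
      using e_ge1[of s] by (intro add_left_mono mult_left_mono) (auto simp: e_def)
    finally show ?thesis by (simp add: algebra_simps)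
  qed
  define G where "G v t = (1 / e t) *\<^sub>R (K v t - K v 0)" for v t
  have "G v \<in> bcontfun" for v
  proof (rule bcontfun_normI)
    have "continuous_on UNIV (K v)"
      using K by (meson continuous_at_imp_continuous_on has_vector_derivative_continuous)
    then show "continuous_on UNIV (G v)"
      unfolding G_def using e_pos by (intro continuous_intros e_cont) (auto simp: less_imp_neq[symmetric])
    show "norm (G v t) \<le> (L * dist v 0 + norm (f u0)) / (2 * L)" for t
      using norm_increment_le_exp[OF \<open>L > 0\<close> K k_bound, of v t] e_pos[of t]
      by (simp add: G_def divide_le_eq e_def)
  qed
  then have G: "apply_bcontfun (Bcontfun (G v)) = G v" for v
    by (rule Bcontfun_inverse)
  have "\<exists>!v. Bcontfun (G v) = v"
  proof (rule banach_fix_type[of "1 / 2"])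
    show "\<forall>v w. dist (Bcontfun (G v)) (Bcontfun (G w)) \<le> 1 / 2 * dist v w"
    proof (intro allI dist_bound)
      fix v w t
      have "((\<lambda>s. K v s - K w s) has_vector_derivative k v s - k w s) (at s)" for s
        by (intro derivative_intros K)
      from norm_increment_le_exp[OF \<open>L > 0\<close> this k_diff, of t]
      have "norm ((K v t - K w t) - (K v 0 - K w 0)) \<le> dist v w / 2 * e t"
        using \<open>L > 0\<close> by (simp add: e_def)
      moreover have "G v t - G w t = (1 / e t) *\<^sub>R ((K v t - K w t) - (K v 0 - K w 0))"
        unfolding G_def by (simp add: algebra_simps)
      ultimately show "dist (apply_bcontfun (Bcontfun (G v)) t) (apply_bcontfun (Bcontfun (G w)) t)
          \<le> 1 / 2 * dist v w"
        unfolding G dist_norm using e_pos[of t] by (simp add: divide_le_eq)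
    qed
  qed auto
  then obtain v where "Bcontfun (G v) = v" by blast
  then have v: "apply_bcontfun v t = G v t" for t by (metis G)
  define u where "u t = u0 + (K v t - K v 0)" for t
  have "k v t = f (u t)" for t
    unfolding k_def u_def v G_def using e_pos[of t] by simp
  moreover have "(u has_vector_derivative k v t) (at t)" for t
    unfolding u_def by (auto intro!: derivative_eq_intros K)
  ultimately have "u 0 = u0 \<and> (\<forall>t. (u has_vector_derivative f (u t)) (at t))"
    by (simp add: u_def)
  then show ?thesis by blast
qed

text \<open>Gronwall's argument: by Cauchy-Schwarz, \<open>exp (- 2 * L * s)\<close> times the
  squared distance is nonincreasing forward in time; negative times follow from the reversed field.
  The shooting argument takes its continuity in the initial value from here.\<close>

lemma solution_dist_le:
  fixes f :: "'a::euclidean_space \<Rightarrow> 'a"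
  assumes lip: "L-lipschitz_on UNIV f"
    and u: "\<And>t. (u has_vector_derivative f (u t)) (at t)"
    and w: "\<And>t. (w has_vector_derivative f (w t)) (at t)"
  shows "dist (u t) (w t) \<le> exp (L * \<bar>t\<bar>) * dist (u 0) (w 0)"
proof -
  have forward: "dist (u t) (w t) \<le> exp (L * t) * dist (u 0) (w 0)"
    if "t \<ge> 0" and lip: "L-lipschitz_on UNIV h"
      and u: "\<And>t. (u has_vector_derivative h (u t)) (at t)"
      and w: "\<And>t. (w has_vector_derivative h (w t)) (at t)"
    for u w :: "real \<Rightarrow> 'a" and h t
  proof -
    define D where "D s = exp (- 2 * L * s) * ((u s - w s) \<bullet> (u s - w s))" for s
    have D: "(D has_real_derivative
        exp (- 2 * L * s) * (2 * ((u s - w s) \<bullet> (h (u s) - h (w s))) - 2 * L * ((u s - w s) \<bullet> (u s - w s)))) (at s)" for s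
    proof -
      have *: "((\<lambda>s. exp (- 2 * L * s) * (d s \<bullet> d s)) has_real_derivative
          exp (- 2 * L * s) * (2 * (d s \<bullet> d') - 2 * L * (d s \<bullet> d s))) (at s)"
        if "(d has_derivative (\<lambda>r. r *\<^sub>R d')) (at s)" for d :: "real \<Rightarrow> 'a" and d'
        unfolding has_field_derivative_def
        by (auto intro!: derivative_eq_intros that simp: fun_eq_iff algebra_simps inner_commute)
      show ?thesis
        unfolding D_def
        by (rule *) (use has_vector_derivative_diff[OF u w] in \<open>simp add: has_vector_derivative_def\<close>)
    qed
    have "D t \<le> D 0"
    proof (rule DERIV_nonpos_imp_nonincreasing[OF \<open>t \<ge> 0\<close>])
      fix s
      have "(u s - w s) \<bullet> (h (u s) - h (w s)) \<le> norm (u s - w s) * norm (h (u s) - h (w s))"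
        by (rule norm_cauchy_schwarz)
      also have "\<dots> \<le> norm (u s - w s) * (L * norm (u s - w s))"
        using lipschitz_onD[OF lip, of "u s" "w s"] by (intro mult_left_mono) (auto simp: dist_norm)
      also have "\<dots> = L * ((u s - w s) \<bullet> (u s - w s))"
        by (simp add: power2_norm_eq_inner[symmetric] power2_eq_square)
      finally show "\<exists>y. (D has_real_derivative y) (at s) \<and> y \<le> 0"
        using D by (intro exI conjI) (auto simp: mult_nonneg_nonpos)
    qed
    then have "(exp (- L * t) * dist (u t) (w t))\<^sup>2 \<le> (dist (u 0) (w 0))\<^sup>2"
      by (simp add: D_def dist_norm power_mult_distrib power2_norm_eq_inner exp_double[symmetric] mult.assoc)
    then have "exp (- L * t) * dist (u t) (w t) \<le> dist (u 0) (w 0)"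
      by (simp add: power2_le_iff_abs_le)
    then show ?thesis
      by (simp add: exp_minus field_simps)
  qed
  show ?thesis
  proof (cases "t \<ge> 0")
    case True
    then show ?thesis using forward[OF _ lip u w] by simp
  next
    case False
    have "((\<lambda>s. v (- s)) has_vector_derivative - f (v (- s))) (at s)"
      if "\<And>t. (v has_vector_derivative f (v t)) (at t)" for v s
      by (rule has_vector_derivative_reflect[OF that])
    from forward[of "- t" "\<lambda>x. - f x", OF _ _ this[OF u] this[OF w]] lip False
    show ?thesis by simp
  qed
qed

section \<open>Limits of real functions\<close>

lemma tendsto_at_bot_mono:
  fixes f :: "real \<Rightarrow> real"
  assumes mono: "\<And>s t. s \<le> t \<Longrightarrow> t \<le> b \<Longrightarrow> f s \<le> f t" and bound: "\<And>t. t \<le> b \<Longrightarrow> m \<le> f t"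
  obtains l where "(f \<longlongrightarrow> l) at_bot" "m \<le> l" "\<And>t. t \<le> b \<Longrightarrow> l \<le> f t"
proof
  let ?l = "INF t\<in>{..b}. f t"
  have bdd: "bdd_below (f ` {..b})" using bound by (auto intro!: bdd_belowI2)
  show *: "?l \<le> f t" if "t \<le> b" for t using that bdd by (auto intro: cINF_lower)
  show "m \<le> ?l" using bound by (intro cINF_greatest) auto
  show "(f \<longlongrightarrow> ?l) at_bot"
  proof (rule decreasing_tendsto)
    show "\<forall>\<^sub>F t in at_bot. ?l \<le> f t"
      using * by (auto simp: eventually_at_bot_linorder)
    fix z assume "?l < z"
    then obtain s where "s \<le> b" "f s < z"
      using bdd by (subst (asm) cINF_less_iff) auto
    then show "\<forall>\<^sub>F t in at_bot. f t < z"
      using mono by (auto simp: eventually_at_bot_linorder intro: le_less_trans)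
  qed
qed

lemma tendsto_at_top_mono:
  fixes f :: "real \<Rightarrow> real"
  assumes mono: "\<And>s t. s \<le> t \<Longrightarrow> f s \<le> f t" and bound: "\<And>t. f t \<le> m"
  obtains l where "(f \<longlongrightarrow> l) at_top" "\<And>t. f t \<le> l"
proof -
  obtain l where l: "((\<lambda>t. - f (- t)) \<longlongrightarrow> l) at_bot" "\<And>t. t \<le> 0 \<Longrightarrow> l \<le> - f (- t)"
    by (rule tendsto_at_bot_mono[of 0 "\<lambda>t. - f (- t)" "- m"]) (use mono bound in auto)
  have "(f \<longlongrightarrow> - l) at_top"
    using tendsto_minus[OF l(1)] by (simp add: filterlim_at_bot_mirror)
  moreover have "f t \<le> - l" for t
    using l(2)[of "- max t 0"] mono[of t "max t 0"] by simp
  ultimately show ?thesis using that by blast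
qed

text \<open>The increment of \<open>f\<close> over \<open>[t, t + d]\<close> tends to 0, so the mean
  value theorem gives a nearby point where \<open>f'\<close> is small, and uniform continuity
  carries this to \<open>t\<close>. The filter is left general to serve both ends of time.\<close>

lemma barbalat:
  fixes f f' :: "real \<Rightarrow> real"
  assumes deriv: "\<And>t. (f has_real_derivative f' t) (at t)"
    and uc: "uniformly_continuous_on UNIV f'"
    and lim: "(f \<longlongrightarrow> l) F"
    and shift: "\<And>h. filterlim (\<lambda>t. t + h) F F"
  shows "(f' \<longlongrightarrow> 0) F"
proof (rule tendstoI)
  fix e :: real assume "e > 0"
  obtain d where d: "d > 0" "\<And>s t. dist s t < d \<Longrightarrow> dist (f' s) (f' t) < e / 2"
    using uc \<open>e > 0\<close> unfolding uniformly_continuous_on_def by (metis UNIV_I half_gt_zero)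
  have "((\<lambda>t. f (t + d) - f t) \<longlongrightarrow> l - l) F"
    using filterlim_compose[OF lim shift] lim by (rule tendsto_diff)
  then have "\<forall>\<^sub>F t in F. dist (f (t + d) - f t) 0 < d * (e / 2)"
    using \<open>d > 0\<close> \<open>e > 0\<close> by (intro tendstoD) auto
  then show "\<forall>\<^sub>F t in F. dist (f' t) 0 < e"
  proof eventually_elim
    case (elim t)
    obtain s where s: "t < s" "s < t + d" "f (t + d) - f t = d * f' s"
      using MVT2[of t "t + d" f f'] \<open>d > 0\<close> deriv by auto
    then have "\<bar>f' s\<bar> < e / 2"
      using elim \<open>d > 0\<close> by (simp add: abs_mult)
    moreover have "\<bar>f' t - f' s\<bar> < e / 2"
      using d(2)[of t s] s by (auto simp: dist_real_def)
    ultimately show ?case unfolding dist_real_def by linarith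
  qed
qed

lemma filterlim_shift_at_top: "filterlim (\<lambda>t::real. t + h) at_top at_top"
  unfolding filterlim_at_top eventually_at_top_linorder
proof
  fix Z show "\<exists>N. \<forall>n\<ge>N. Z \<le> n + h" by (intro exI[of _ "Z - h"]) auto
qed

lemma filterlim_shift_at_bot: "filterlim (\<lambda>t::real. t + h) at_bot at_bot"
  unfolding filterlim_at_bot eventually_at_bot_linorder
proof
  fix Z show "\<exists>N. \<forall>n\<le>N. n + h \<le> Z" by (intro exI[of _ "Z - h"]) auto
qed

text \<open>The derivative is controlled only below the level \<open>b\<close>, yet going backwards
  \<open>f\<close> cannot leave that region: after the last time at which \<open>f\<close> reaches a
  level \<open>m\<close> strictly between \<open>f T\<close> and \<open>b\<close>, it stays below
  \<open>b\<close> and so cannot decrease to \<open>f T\<close>.\<close>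

lemma le_of_nonneg_derivative_below:
  fixes f f' :: "real \<Rightarrow> real"
  assumes deriv: "\<And>t. (f has_real_derivative f' t) (at t)"
    and nonneg: "\<And>t. t \<le> T \<Longrightarrow> f t < b \<Longrightarrow> f' t \<ge> 0"
    and "f T < b" "t \<le> T"
  shows "f t \<le> f T"
proof (rule ccontr)
  assume "\<not> f t \<le> f T"
  then obtain m where m: "f T < m" "m < b" "m < f t"
    using dense[of "f T" "min b (f t)"] \<open>f T < b\<close> by auto
  have cont: "continuous_on A f" for A
    using deriv by (meson DERIV_continuous_on DERIV_subset subset_UNIV)
  define S where "S = {s \<in> {t..T}. m \<le> f s}"
  have "closed S"
    unfolding S_def by (intro continuous_on_closed_Collect_le continuous_intros cont closed_atLeastAtMost)
  moreover have S_bdd: "bdd_above S" and S_ne: "S \<noteq> {}"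
    using m \<open>t \<le> T\<close> by (auto simp: S_def intro!: bdd_aboveI[of _ T])
  ultimately have "Sup S \<in> S" by (simp add: closed_contains_Sup)
  then have s: "Sup S \<le> T" "m \<le> f (Sup S)" by (auto simp: S_def)
  have above: "f r < m" if "Sup S < r" "r \<le> T" for r
    using that \<open>Sup S \<in> S\<close> cSup_upper[OF _ S_bdd, of r] by (fastforce simp: S_def)
  have "f (Sup S) \<le> f T"
  proof (rule DERIV_nonneg_imp_increasing_open[of "Sup S" T f])
    show "\<exists>y. (f has_real_derivative y) (at r) \<and> 0 \<le> y" if "Sup S < r" "r < T" for r
      using that above[of r] m nonneg[of r] deriv by auto
  qed (rule s cont)+
  with s m show False by simp
qed

lemma continuous_attains_between_limits:
  fixes f :: "real \<Rightarrow> real"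
  assumes "\<And>t. isCont f t" "(f \<longlongrightarrow> l) at_bot" "(f \<longlongrightarrow> m) at_top" "l < b" "b < m"
  shows "\<exists>t. f t = b"
proof -
  obtain t1 where t1: "f t1 < b"
    using order_tendstoD(2)[OF assms(2,4)] by (auto simp: eventually_at_bot_linorder)
  obtain t2 where "f t2 > b" "t2 \<ge> t1"
    using order_tendstoD(1)[OF assms(3,5)] unfolding eventually_at_top_linorder
    by (metis max.cobounded1 max.cobounded2)
  then show ?thesis using IVT[of f t1 b t2] t1 assms(1) by force
qed

section \<open>Limit sets of convergent orbits, and compactness of the state space\<close>

lemma omega_limit_eq_singleton:
  assumes "(u \<longlongrightarrow> p) at_top"
  shows "omega_limit u = {p}"
proof -
  have "(\<lambda>n. u (s n)) \<longlonglongrightarrow> p" if "filterlim s at_top sequentially" for s :: "nat \<Rightarrow> real"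
    using filterlim_compose[OF assms that] .
  then show ?thesis
    using filterlim_real_sequentially
    by (fastforce simp: omega_limit_def intro: LIMSEQ_unique)
qed

lemma alpha_limit_eq_singleton:
  assumes "(u \<longlongrightarrow> p) at_bot"
  shows "alpha_limit u = {p}"
proof -
  have "(\<lambda>n. u (s n)) \<longlonglongrightarrow> p" if "filterlim s at_bot sequentially" for s :: "nat \<Rightarrow> real"
    using filterlim_compose[OF assms that] .
  moreover have "filterlim (\<lambda>n. - real n) at_bot sequentially"
    using filterlim_real_sequentially by (simp add: filterlim_uminus_at_top)
  ultimately show ?thesis
    by (fastforce simp: alpha_limit_def intro: LIMSEQ_unique)
qed

lemma compact_state_space: "compact state_space"
proof -
  have "closed state_space"
    unfolding state_space_def OmegaV_def
    by (intro closed_Collect_conj closed_Collect_le continuous_intros)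
  moreover have "state_space \<subseteq> cbox (-1, 0) (1, 1)"
  proof
    fix p assume "p \<in> state_space"
    then have "(fst p)\<^sup>2 \<le> 1" "snd p \<le> 1" "snd p \<ge> 0"
      using zero_le_power2[of "fst p"] unfolding state_space_def OmegaV_def mem_Collect_eq
      by linarith+
    then show "p \<in> cbox (-1, 0) (1, 1)"
      using abs_square_le_1[of "fst p"] by (cases p) auto
  qed
  ultimately show ?thesis
    by (meson bounded_cbox bounded_subset compact_eq_bounded_closed)
qed

section \<open>Future and past limits of interior orbits\<close>

locale cosmology =
  fixes lam gam :: real
  assumes lam_nonneg: "lam \<ge> 0" and gam_pos: "0 < gam" and gam_less: "gam < 2"
    and lam_gam: "gam \<ge> lam\<^sup>2 / 3"
begin

definition a :: real where "a = lam / sqrt 6"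

definition g :: real where "g = gam / 2"

lemma g_pos: "g > 0" and g_less_1: "g < 1"
  using gam_pos gam_less by (simp_all add: g_def)

lemma a_nonneg: "a \<ge> 0"
  using lam_nonneg by (simp add: a_def)

lemma a_sq_le_g: "a\<^sup>2 \<le> g"
  using lam_gam by (simp add: a_def g_def power_divide)

lemma a_less_1: "a < 1"
  using a_sq_le_g g_less_1 a_nonneg by (meson le_less_trans power2_less_1_iff abs_square_less_1 abs_of_nonneg abs_ge_self)

text \<open>Eliminating \<open>q\<close> through \<open>x^2 + y + V = 1\<close> displays the terms
  whose signs decide the direction of motion.\<close>

lemma vf_eq:
  "vf lam gam p = (3 * ((a - fst p) * OmegaV p - (1 - g) * fst p * snd p),
     6 * snd p * ((1 - g) * (fst p)\<^sup>2 - g * OmegaV p))"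
proof -
  have "sqrt (3 / 2) = 3 / sqrt 6"
    by (rule real_sqrt_unique) (auto simp: power_divide)
  then have "sqrt (3 / 2) * lam = 3 * a" by (simp add: a_def)
  then have "vf lam gam p =
      (- (2 - qdec gam p) * fst p + 3 * a * OmegaV p, (2 * (1 + qdec gam p) - 3 * gam) * snd p)"
    by (simp add: vf_def)
  then show ?thesis
    unfolding qdec_def OmegaV_def by (simp add: g_def field_simps power2_eq_square)
qed

lemma continuous_on_vf: "continuous_on A (vf lam gam)"
  unfolding vf_eq[abs_def] OmegaV_def by (intro continuous_intros)

end

locale interior_orbit = cosmology +
  fixes u :: "real \<Rightarrow> real \<times> real"
  assumes sol: "interior_solution lam gam u"
begin

abbreviation x :: "real \<Rightarrow> real" where "x t \<equiv> fst (u t)"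
abbreviation y :: "real \<Rightarrow> real" where "y t \<equiv> snd (u t)"
abbreviation V :: "real \<Rightarrow> real" where "V t \<equiv> OmegaV (u t)"

lemma y_pos: "y t > 0" and V_pos: "V t > 0"
  using sol by (auto simp: interior_solution_def interior_set_def)

lemma V_eq: "V t = 1 - (x t)\<^sup>2 - y t"
  by (simp add: OmegaV_def)

lemma x_sq_less_1: "(x t)\<^sup>2 < 1"
  using y_pos[of t] V_pos[of t] unfolding V_eq by linarith

lemma x_bounds: "-1 < x t" "x t < 1"
  using x_sq_less_1[of t] by (auto simp: abs_square_less_1)

lemma ax_less_1: "a * x t < 1" and ax_gt: "-1 < a * x t"
proof -
  have "\<bar>a * x t\<bar> \<le> 1 * \<bar>x t\<bar>"
    unfolding abs_mult using a_nonneg a_less_1 by (intro mult_right_mono) auto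
  then show "a * x t < 1" "-1 < a * x t"
    using x_bounds[of t] by linarith+
qed

lemma u_deriv: "(u has_vector_derivative vf lam gam (u t)) (at t)"
  using sol by (simp add: interior_solution_def)

text \<open>Taken as a function of the state, like \<open>Mdot\<close> below, so that continuity on
  the compact state space yields uniform continuity in time.\<close>

definition xdot :: "real \<times> real \<Rightarrow> real"
  where "xdot p = 3 * ((a - fst p) * OmegaV p - (1 - g) * fst p * snd p)"

lemma D_x: "(x has_real_derivative xdot (u t)) (at t)"
  and D_y: "(y has_real_derivative 6 * y t * ((1 - g) * (x t)\<^sup>2 - g * V t)) (at t)"
proof -
  have *: "(u has_derivative (\<lambda>h. h *\<^sub>R vf lam gam (u t))) (at t)"
    using u_deriv by (simp add: has_vector_derivative_def)
  show "(x has_real_derivative xdot (u t)) (at t)"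
    unfolding has_field_derivative_def
    by (rule has_derivative_eq_rhs[OF has_derivative_fst[OF *]]) (simp add: fun_eq_iff vf_eq xdot_def)
  show "(y has_real_derivative 6 * y t * ((1 - g) * (x t)\<^sup>2 - g * V t)) (at t)"
    unfolding has_field_derivative_def
    by (rule has_derivative_eq_rhs[OF has_derivative_snd[OF *]]) (simp add: fun_eq_iff vf_eq)
qed

lemma D_V: "(V has_real_derivative 6 * V t * ((x t)\<^sup>2 + g * y t - a * x t)) (at t)"
proof -
  have "(V has_real_derivative - (2 * x t * xdot (u t)) - 6 * y t * ((1 - g) * (x t)\<^sup>2 - g * V t)) (at t)"
    unfolding V_eq[abs_def] by (auto intro!: derivative_eq_intros D_x D_y simp: V_eq)
  then show ?thesis
    by (rule back_subst[where P = "\<lambda>d. (V has_real_derivative d) (at t)"])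
      (simp add: xdot_def V_eq algebra_simps power2_eq_square)
qed

lemma u_in_state_space: "u t \<in> state_space"
  using y_pos[of t] V_pos[of t] by (simp add: state_space_def)

text \<open>The field is bounded on the compact state space, so \<open>u\<close> is Lipschitz, and
  \<open>G\<close> is uniformly continuous there. This is the regularity that Barbalat's lemma asks
  for.\<close>

lemma uniformly_continuous_along:
  assumes "continuous_on state_space G"
  shows "uniformly_continuous_on UNIV (\<lambda>t. G (u t) :: real)"
proof -
  have "compact (vf lam gam ` state_space)"
    by (intro compact_continuous_image continuous_on_vf compact_state_space)
  then obtain B where B: "B > 0" "\<And>p. p \<in> state_space \<Longrightarrow> norm (vf lam gam p) \<le> B"
    by (metis bounded_pos compact_imp_bounded imageI)
  have "B-lipschitz_on UNIV u"
  proof (rule bounded_derivative_imp_lipschitz)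
    show "(u has_derivative (\<lambda>h. h *\<^sub>R vf lam gam (u t))) (at t within UNIV)" for t
      using u_deriv by (simp add: has_vector_derivative_def)
    show "onorm (\<lambda>h. h *\<^sub>R vf lam gam (u t)) \<le> B" for t
      using B(2)[OF u_in_state_space, of t]
      by (intro onorm_le) (metis abs_ge_zero mult.commute mult_left_mono norm_scaleR real_norm_def)
  qed (use B in auto)
  then have u: "uniformly_continuous_on UNIV u"
    by (rule lipschitz_on_uniformly_continuous)
  have "uniformly_continuous_on (range u) G"
    using compact_uniformly_continuous[OF assms compact_state_space] u_in_state_space
    by (auto simp: uniformly_continuous_on_def subset_iff) (metis rangeI u_in_state_space)
  from uniformly_continuous_on_compose[OF u this] show ?thesis by (simp add: o_def)
qed

lemma derivative_along_tendsto_0: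
  assumes "continuous_on state_space G"
    and "\<And>t. (h has_real_derivative G (u t)) (at t)"
    and "(h \<longlongrightarrow> l) F" and "F = at_top \<or> F = at_bot"
  shows "((\<lambda>t. G (u t)) \<longlongrightarrow> 0) F"
  using assms(4) filterlim_shift_at_top filterlim_shift_at_bot
  by (intro barbalat[OF assms(2) uniformly_continuous_along[OF assms(1)] assms(3)]) auto

lemma xdot_tendsto_0:
  assumes "(x \<longlongrightarrow> l) F" and "F = at_top \<or> F = at_bot"
  shows "((\<lambda>t. xdot (u t)) \<longlongrightarrow> 0) F"
  by (rule derivative_along_tendsto_0[OF _ D_x assms])
    (unfold xdot_def OmegaV_def, intro continuous_intros)

section \<open>The monotone function and convergence to P\<close>

definition M :: "real \<Rightarrow> real" where "M t = V t / (1 - a * x t)\<^sup>2"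

definition Mdot :: "real \<times> real \<Rightarrow> real"
  where "Mdot p = 6 * OmegaV p * ((fst p - a)\<^sup>2 + (g - a\<^sup>2) * snd p) / (1 - a * fst p) ^ 3"

lemma M_pos: "M t > 0"
  unfolding M_def using V_pos[of t] ax_less_1[of t] by simp

text \<open>After one factor \<open>1 - a * x t\<close> is taken out, the numerator reduces, by
  \<open>V = 1 - x^2 - y\<close>, to \<open>(x - a)^2 + (g - a^2) * y\<close>. The hypothesis on
  \<open>gam\<close> makes this nonnegative.\<close>

lemma D_M: "(M has_real_derivative Mdot (u t)) (at t)"
proof -
  have nz: "1 - a * x t \<noteq> 0" using ax_less_1[of t] by simp
  have "(M has_real_derivative
      (6 * V t * ((x t)\<^sup>2 + g * y t - a * x t) * (1 - a * x t)\<^sup>2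
        + V t * (2 * (1 - a * x t) * (a * xdot (u t)))) / ((1 - a * x t)\<^sup>2 * (1 - a * x t)\<^sup>2)) (at t)"
    unfolding M_def[abs_def]
    by (rule derivative_eq_intros D_V D_x refl)+ (use nz in \<open>auto simp: algebra_simps\<close>)
  moreover have "(6 * V t * ((x t)\<^sup>2 + g * y t - a * x t) * (1 - a * x t)\<^sup>2
        + V t * (2 * (1 - a * x t) * (a * xdot (u t))))
      = 6 * V t * (1 - a * x t) * (((x t)\<^sup>2 + g * y t - a * x t) * (1 - a * x t)
        + a * ((a - x t) * V t - (1 - g) * x t * y t))"
    by (simp add: xdot_def algebra_simps power2_eq_square)
  moreover have "((x t)\<^sup>2 + g * y t - a * x t) * (1 - a * x t)
        + a * ((a - x t) * V t - (1 - g) * x t * y t) = (x t - a)\<^sup>2 + (g - a\<^sup>2) * y t"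
    by (simp add: V_eq algebra_simps power2_eq_square)
  ultimately have "(M has_real_derivative
      (6 * V t * (1 - a * x t) * ((x t - a)\<^sup>2 + (g - a\<^sup>2) * y t)) /
      ((1 - a * x t)\<^sup>2 * (1 - a * x t)\<^sup>2)) (at t)"
    by simp
  moreover have "(6 * v * c * e) / (c\<^sup>2 * c\<^sup>2) = 6 * v * e / c ^ 3" if "c \<noteq> 0" for v c e :: real
    using that by (simp add: field_simps power2_eq_square power3_eq_cube)
  note this[OF nz, of "V t" "(x t - a)\<^sup>2 + (g - a\<^sup>2) * y t", folded Mdot_def]
  ultimately show ?thesis by simp
qed

lemma Mdot_nonneg: "Mdot (u t) \<ge> 0"
  unfolding Mdot_def using V_pos[of t] y_pos[of t] ax_less_1[of t] a_sq_le_g by simp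

lemma M_mono: "s \<le> t \<Longrightarrow> M s \<le> M t"
  using DERIV_nonneg_imp_nondecreasing[of s t M] D_M Mdot_nonneg by blast

text \<open>The bound is the value of \<open>M\<close> at P. It follows from the identity
  \<open>(1 - x^2) * (1 - a^2) = (1 - a * x)^2 - (x - a)^2\<close>, and is strict because
  \<open>y > 0\<close>.\<close>

lemma M_less: "M t < 1 / (1 - a\<^sup>2)"
proof -
  have "V t * (1 - a\<^sup>2) < (1 - (x t)\<^sup>2) * (1 - a\<^sup>2)"
    using y_pos[of t] a_sq_le_g g_less_1 by (simp add: V_eq)
  also have "\<dots> = (1 - a * x t)\<^sup>2 - (x t - a)\<^sup>2"
    by (simp add: algebra_simps power2_eq_square)
  also have "\<dots> \<le> (1 - a * x t)\<^sup>2" by simp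
  finally show ?thesis
    unfolding M_def using ax_less_1[of t] a_sq_le_g g_less_1 by (simp add: field_simps)
qed

text \<open>By Barbalat \<open>Mdot\<close> tends to 0. Dividing by \<open>6 * M\<close>, whose
  limit is positive, leaves \<open>((x - a)^2 + (g - a^2) * y) / (1 - a * x)\<close>, and
  \<open>1 - a * x < 2\<close> lets both nonnegative summands of the numerator be squeezed to
  0.\<close>

lemma tendsto_P:
  assumes M: "(M \<longlongrightarrow> l) F" and "l > 0" and F: "F = at_top \<or> F = at_bot"
  shows "(x \<longlongrightarrow> a) F" and "(y \<longlongrightarrow> 0) F"
proof -
  have "((\<lambda>t. Mdot (u t)) \<longlongrightarrow> 0) F"
  proof (rule derivative_along_tendsto_0[OF _ D_M M F])
    have "a * fst p \<noteq> 1" if "p \<in> state_space" for p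
    proof -
      have "(fst p)\<^sup>2 \<le> 1" using that unfolding state_space_def OmegaV_def by auto
      then have "fst p \<le> 1" by (simp add: abs_square_le_1 abs_le_iff)
      then have "a * fst p \<le> a" using a_nonneg by (simp add: mult_left_le)
      then show ?thesis using a_less_1 by linarith
    qed
    then show "continuous_on state_space Mdot"
      unfolding Mdot_def OmegaV_def by (intro continuous_intros) auto
  qed
  then have "((\<lambda>t. 2 * (Mdot (u t) / (6 * M t))) \<longlongrightarrow> 2 * (0 / (6 * l))) F"
    using \<open>l > 0\<close> by (intro tendsto_intros M) auto
  then have Q: "((\<lambda>t. 2 * (Mdot (u t) / (6 * M t))) \<longlongrightarrow> 0) F" by simp
  have E_le: "(x t - a)\<^sup>2 + (g - a\<^sup>2) * y t \<le> 2 * (Mdot (u t) / (6 * M t))" for t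
  proof -
    let ?E = "(x t - a)\<^sup>2 + (g - a\<^sup>2) * y t"
    have "6 * v * e / c ^ 3 / (6 * (v / c\<^sup>2)) = e / c" if "0 \<noteq> v" "c \<noteq> 0" for v c e :: real
      using that by (simp add: field_simps power2_eq_square power3_eq_cube)
    then have "Mdot (u t) / (6 * M t) = ?E / (1 - a * x t)"
      unfolding Mdot_def M_def using less_imp_neq[OF V_pos[of t]] ax_less_1[of t] by (metis diff_gt_0_iff_gt less_irrefl)
    moreover have "?E * (1 - a * x t) \<le> 2 * ?E"
      unfolding mult.commute[of 2]
      using ax_gt[of t] a_sq_le_g y_pos[of t] by (intro mult_left_mono) auto
    then have "?E \<le> 2 * ?E / (1 - a * x t)"
      using ax_less_1[of t] by (subst pos_le_divide_eq) auto
    ultimately show ?thesis by simp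
  qed
  have "((\<lambda>t. (x t - a)\<^sup>2) \<longlongrightarrow> 0) F"
  proof (rule tendsto_sandwich[OF _ _ tendsto_const Q])
    have "(x t - a)\<^sup>2 \<le> 2 * (Mdot (u t) / (6 * M t))" for t
      using E_le[of t] a_sq_le_g y_pos[of t] mult_nonneg_nonneg[of "g - a\<^sup>2" "y t"] by linarith
    then show "\<forall>\<^sub>F t in F. (x t - a)\<^sup>2 \<le> 2 * (Mdot (u t) / (6 * M t))" by simp
  qed simp
  then have "((\<lambda>t. x t - a) \<longlongrightarrow> 0) F"
    using tendsto_real_sqrt[of "\<lambda>t. (x t - a)\<^sup>2" 0 F] by (simp add: tendsto_rabs_zero_iff)
  then show x: "(x \<longlongrightarrow> a) F" by (simp add: LIM_zero_iff)
  show "(y \<longlongrightarrow> 0) F"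
  proof (cases "g = a\<^sup>2")
    case False
    have "((\<lambda>t. (g - a\<^sup>2) * y t) \<longlongrightarrow> 0) F"
    proof (rule tendsto_sandwich[OF _ _ tendsto_const Q])
      have "(g - a\<^sup>2) * y t \<le> 2 * (Mdot (u t) / (6 * M t))" for t
        using E_le[of t] zero_le_power2[of "x t - a"] by linarith
      then show "\<forall>\<^sub>F t in F. (g - a\<^sup>2) * y t \<le> 2 * (Mdot (u t) / (6 * M t))" by simp
      show "\<forall>\<^sub>F t in F. 0 \<le> (g - a\<^sup>2) * y t"
        using a_sq_le_g y_pos by (intro always_eventually allI mult_nonneg_nonneg) (auto intro: less_imp_le)
    qed
    then have "((\<lambda>t. ((g - a\<^sup>2) * y t) / (g - a\<^sup>2)) \<longlongrightarrow> 0 / (g - a\<^sup>2)) F"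
      using False by (intro tendsto_divide tendsto_const) auto
    then show ?thesis using False by simp
  next
    case True
    \<comment> \<open>In the borderline case the numerator no longer contains \<open>y\<close>.
      Instead \<open>x\<close> tends to \<open>a\<close>, so Barbalat gives \<open>xdot\<close>
      tending to 0; solving the equation for \<open>xdot\<close> for \<open>y\<close> has a
      denominator with limit \<open>(1 - g) * a\<close>, which is nonzero.\<close>
    then have "a \<noteq> 0" using g_pos by auto
    let ?d = "\<lambda>t. (a - x t) + (1 - g) * x t"
    have d: "(?d \<longlongrightarrow> (a - a) + (1 - g) * a) F"
      by (intro tendsto_intros x)
    have nz: "(a - a) + (1 - g) * a \<noteq> 0" using \<open>a \<noteq> 0\<close> g_less_1 by simp
    have "((\<lambda>t. ((a - x t) * (1 - (x t)\<^sup>2) - xdot (u t) / 3) / ?d t)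
        \<longlongrightarrow> ((a - a) * (1 - a\<^sup>2) - 0 / 3) / ((a - a) + (1 - g) * a)) F"
      by (intro tendsto_intros x xdot_tendsto_0[OF x F] nz) simp
    moreover have "\<forall>\<^sub>F t in F. ((a - x t) * (1 - (x t)\<^sup>2) - xdot (u t) / 3) / ?d t = y t"
      using tendsto_imp_eventually_ne[OF d nz]
      by eventually_elim (simp add: xdot_def V_eq field_simps)
    ultimately show ?thesis
      by (simp add: filterlim_cong[OF refl refl])
  qed
qed

lemma tendsto_pair: "(x \<longlongrightarrow> b) F \<Longrightarrow> (y \<longlongrightarrow> c) F \<Longrightarrow> (u \<longlongrightarrow> (b, c)) F"
  using tendsto_Pair[of x b F y c] by simp

lemma tendsto_P_at_top: "(x \<longlongrightarrow> a) at_top" "(y \<longlongrightarrow> 0) at_top"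
proof -
  obtain l where l: "(M \<longlongrightarrow> l) at_top" "\<And>t. M t \<le> l"
    by (rule tendsto_at_top_mono[of M "1 / (1 - a\<^sup>2)"]) (use M_mono M_less in \<open>auto intro: less_imp_le\<close>)
  have "l > 0" using l(2)[of 0] M_pos[of 0] by linarith
  then show "(x \<longlongrightarrow> a) at_top" "(y \<longlongrightarrow> 0) at_top"
    using tendsto_P[OF l(1)] by auto
qed

lemma omega_limit_eq: "omega_limit u = {Ppt lam}"
  using omega_limit_eq_singleton[OF tendsto_pair[OF tendsto_P_at_top]] by (simp add: Ppt_def a_def)

text \<open>If the backward limit of \<open>M\<close> were positive, the orbit would tend to P in
  the past, so that limit would be the value of \<open>M\<close> at P. But it is at most
  \<open>M 0\<close>, which is strictly smaller. Finally \<open>V = M * (1 - a * x)^2\<close> is at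
  most \<open>4 * M\<close>.\<close>

lemma V_at_bot: "(V \<longlongrightarrow> 0) at_bot"
proof -
  obtain l where l: "(M \<longlongrightarrow> l) at_bot" "0 \<le> l" "\<And>t. t \<le> 0 \<Longrightarrow> l \<le> M t"
    by (rule tendsto_at_bot_mono[of 0 M 0]) (use M_mono M_pos in \<open>auto intro: less_imp_le\<close>)
  have "l = 0"
  proof (rule ccontr)
    assume "l \<noteq> 0"
    then have "l > 0" using l by simp
    then have xy: "(x \<longlongrightarrow> a) at_bot" "(y \<longlongrightarrow> 0) at_bot"
      using tendsto_P[OF l(1)] by auto
    have "1 - a * a \<noteq> 0" using a_sq_le_g g_less_1 by (simp add: power2_eq_square)
    then have "((\<lambda>t. (1 - (x t)\<^sup>2 - y t) / (1 - a * x t)\<^sup>2)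
        \<longlongrightarrow> (1 - a\<^sup>2 - 0) / (1 - a * a)\<^sup>2) at_bot"
      by (intro tendsto_intros xy) auto
    then have "(M \<longlongrightarrow> (1 - a\<^sup>2 - 0) / (1 - a * a)\<^sup>2) at_bot"
      by (simp add: M_def[abs_def] V_eq)
    then have "l = (1 - a\<^sup>2 - 0) / (1 - a * a)\<^sup>2"
      using tendsto_unique[OF _ l(1)] by auto
    then have "l = 1 / (1 - a\<^sup>2)"
      using \<open>1 - a * a \<noteq> 0\<close> by (simp add: power2_eq_square)
    then show False using l(3)[of 0] M_less[of 0] by simp
  qed
  then have "((\<lambda>t. 4 * M t) \<longlongrightarrow> 4 * 0) at_bot"
    using l(1) by (intro tendsto_intros) auto
  then have M4: "((\<lambda>t. 4 * M t) \<longlongrightarrow> 0) at_bot" by simp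
  show ?thesis
  proof (rule tendsto_sandwich[OF _ _ tendsto_const M4])
    have "V t \<le> 4 * M t" for t
    proof -
      have "(1 - a * x t)\<^sup>2 \<le> 2\<^sup>2"
        using ax_gt[of t] ax_less_1[of t] by (intro power_mono) auto
      then have "M t * (1 - a * x t)\<^sup>2 \<le> M t * 4"
        using M_pos[of t] by (intro mult_left_mono) auto
      moreover have "V t = M t * (1 - a * x t)\<^sup>2"
        using ax_less_1[of t] by (simp add: M_def)
      ultimately show ?thesis by linarith
    qed
    then show "\<forall>\<^sub>F t in at_bot. V t \<le> 4 * M t" by simp
    show "\<forall>\<^sub>F t in at_bot. 0 \<le> V t" using V_pos by (simp add: less_imp_le)
  qed
qed

section \<open>Monotonicity of x and the possible limits in the past\<close>

lemma xdot_pos: "x t < 0 \<Longrightarrow> xdot (u t) > 0"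
proof -
  assume "x t < 0"
  then have "(a - x t) * V t > 0" "x t * y t < 0"
    using a_nonneg V_pos[of t] y_pos[of t] by (auto simp: mult_neg_pos)
  moreover from this have "(1 - g) * (x t * y t) < 0"
    using g_less_1 by (simp add: mult_pos_neg)
  ultimately show ?thesis by (simp add: xdot_def mult.assoc)
qed

lemma xdot_neg:
  assumes "a \<le> x t" "0 < x t"
  shows "xdot (u t) < 0"
proof -
  have "(a - x t) * V t \<le> 0" "x t * y t > 0"
    using assms V_pos[of t] y_pos[of t] by (auto simp: mult_nonpos_nonneg)
  moreover from this have "(1 - g) * (x t * y t) > 0"
    using g_less_1 by simp
  ultimately show ?thesis by (simp add: xdot_def mult.assoc)
qed

text \<open>A sign condition at the later time alone suffices, because the region
  \<open>x < 0\<close> is invariant backwards in time. The next lemma is the mirrored argument for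
  \<open>x > a\<close>.\<close>

lemma x_mono: "s \<le> t \<Longrightarrow> x t < 0 \<Longrightarrow> x s \<le> x t"
  by (rule le_of_nonneg_derivative_below[OF D_x, of _ 0]) (auto intro: less_imp_le xdot_pos)

lemma x_antimono:
  assumes "s \<le> t" "a < x t"
  shows "x t \<le> x s"
proof -
  have "- x s \<le> - x t"
  proof (rule le_of_nonneg_derivative_below[where f = "\<lambda>t. - x t" and f' = "\<lambda>t. - xdot (u t)" and b = "- a"])
    show "((\<lambda>t. - x t) has_real_derivative - xdot (u r)) (at r)" for r
      by (intro derivative_intros D_x)
  qed (use assms xdot_neg a_nonneg in \<open>auto intro: less_imp_le\<close>)
  then show ?thesis by simp
qed

text \<open>Since \<open>V\<close> tends to 0, the limit point lies on the parabola
  \<open>V = 0\<close>. There \<open>xdot\<close> is a nonzero multiple of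
  \<open>l * (1 - l^2)\<close>, which Barbalat forces to vanish.\<close>

lemma limit_at_bot:
  assumes x: "(x \<longlongrightarrow> l) at_bot"
  shows "(u \<longlongrightarrow> (l, 1 - l\<^sup>2)) at_bot" and "l = -1 \<or> l = 0 \<or> l = 1"
proof -
  have "((\<lambda>t. 1 - (x t)\<^sup>2 - V t) \<longlongrightarrow> 1 - l\<^sup>2 - 0) at_bot"
    by (intro tendsto_intros x V_at_bot)
  then have y: "(y \<longlongrightarrow> 1 - l\<^sup>2) at_bot" by (simp add: V_eq)
  show "(u \<longlongrightarrow> (l, 1 - l\<^sup>2)) at_bot"
    by (rule tendsto_pair[OF x y])
  have "((\<lambda>t. xdot (u t)) \<longlongrightarrow> 3 * ((a - l) * 0 - (1 - g) * l * (1 - l\<^sup>2))) at_bot"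
    unfolding xdot_def by (intro tendsto_intros x y V_at_bot)
  moreover have "((\<lambda>t. xdot (u t)) \<longlongrightarrow> 0) at_bot"
    using xdot_tendsto_0[OF x] by simp
  ultimately have "0 = 3 * ((a - l) * 0 - (1 - g) * l * (1 - l\<^sup>2))"
    using tendsto_unique[of at_bot] by (metis trivial_limit_at_bot_linorder)
  then show "l = -1 \<or> l = 0 \<or> l = 1"
    using g_less_1 by (auto simp: power2_eq_1_iff)
qed

lemma tendsto_Km:
  assumes "x T < 0"
  shows "(u \<longlongrightarrow> Km) at_bot"
proof -
  have neg: "x t < 0" if "t \<le> T" for t
    using x_mono[OF that] assms by linarith
  obtain l where l: "(x \<longlongrightarrow> l) at_bot" "-1 \<le> l" "\<And>t. t \<le> T \<Longrightarrow> l \<le> x t"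
    by (rule tendsto_at_bot_mono[of T x "-1"]) (use x_mono neg x_bounds in \<open>auto intro: less_imp_le\<close>)
  have "l < 0" using l(3)[of T] assms by simp
  then have "l = -1" using limit_at_bot(2)[OF l(1)] by auto
  then show ?thesis using limit_at_bot(1)[OF l(1)] by (simp add: Km_def)
qed

lemma tendsto_Kp:
  assumes "a < x T"
  shows "(u \<longlongrightarrow> Kp) at_bot"
proof -
  have above: "a < x t" if "t \<le> T" for t
    using x_antimono[OF that] assms by linarith
  obtain l where l: "((\<lambda>t. - x t) \<longlongrightarrow> l) at_bot" "-1 \<le> l" "\<And>t. t \<le> T \<Longrightarrow> l \<le> - x t"
    by (rule tendsto_at_bot_mono[of T "\<lambda>t. - x t" "-1"])
      (use x_antimono above x_bounds in \<open>auto intro: less_imp_le\<close>)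
  have x: "(x \<longlongrightarrow> - l) at_bot" using tendsto_minus[OF l(1)] by simp
  have "l < 0" using l(3)[of T] assms a_nonneg by simp
  then have "l = -1" using limit_at_bot(2)[OF x] l(2) by auto
  then show ?thesis using limit_at_bot(1)[OF x] by (simp add: Kp_def)
qed

text \<open>Between 0 and \<open>a\<close> the sign of \<open>xdot\<close> is not fixed, so
  convergence of \<open>x\<close> is not immediate. But if \<open>x\<close> reached \<open>e\<close>
  at a sufficiently early time, it would increase backwards from there to a limit in
  \<open>[e, a]\<close>, and no such limit is allowed.\<close>

lemma tendsto_FL:
  assumes bounds: "\<And>t. 0 \<le> x t" "\<And>t. x t \<le> a"
  shows "(u \<longlongrightarrow> FL) at_bot"
proof -
  have "(x \<longlongrightarrow> 0) at_bot"
  proof (rule decreasing_tendsto)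
    show "\<forall>\<^sub>F t in at_bot. 0 \<le> x t" using bounds by simp
    fix e :: real assume "e > 0"
    \<comment> \<open>\<open>3 * W\<close> bounds \<open>xdot\<close> from above where
      \<open>e / 2 < x\<close>, using \<open>y = 1 - x^2 - V\<close> and
      \<open>x^2 \<le> a^2\<close>. As \<open>V\<close> tends to 0, \<open>W\<close> becomes
      negative.\<close>
    define W where "W t = a * V t - (1 - g) * (e / 2 * (1 - a\<^sup>2 - V t))" for t
    have "(W \<longlongrightarrow> a * 0 - (1 - g) * (e / 2 * (1 - a\<^sup>2 - 0))) at_bot"
      unfolding W_def[abs_def] by (intro tendsto_intros V_at_bot) auto
    moreover have "a * 0 - (1 - g) * (e / 2 * (1 - a\<^sup>2 - 0)) < 0"
      using g_less_1 a_sq_le_g \<open>e > 0\<close> by simp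
    ultimately have "\<forall>\<^sub>F t in at_bot. W t < 0" by (rule order_tendstoD)
    then obtain T where T: "\<And>t. t \<le> T \<Longrightarrow> W t < 0"
      by (auto simp: eventually_at_bot_linorder)
    have xdot_le: "xdot (u t) \<le> 0" if "t \<le> T" "e / 2 < x t" for t
    proof -
      have "(a - x t) * V t \<le> a * V t"
        using bounds[of t] V_pos[of t] by (intro mult_right_mono) auto
      moreover have "e / 2 * (1 - a\<^sup>2 - V t) \<le> x t * y t"
      proof -
        have "(x t)\<^sup>2 \<le> a\<^sup>2" using bounds[of t] by (intro power_mono) auto
        then have "e / 2 * (1 - a\<^sup>2 - V t) \<le> e / 2 * y t"
          using \<open>e > 0\<close> by (intro mult_left_mono) (auto simp: V_eq)
        also have "\<dots> \<le> x t * y t"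
          using that y_pos[of t] by (intro mult_right_mono) auto
        finally show ?thesis .
      qed
      then have "(1 - g) * (e / 2 * (1 - a\<^sup>2 - V t)) \<le> (1 - g) * (x t * y t)"
        using g_less_1 by (intro mult_left_mono) auto
      ultimately have "xdot (u t) \<le> 3 * W t"
        by (simp add: xdot_def W_def mult.assoc)
      then show ?thesis using T[OF that(1)] by simp
    qed
    have "x t < e" if "t \<le> T" for t
    proof (rule ccontr)
      assume "\<not> x t < e"
      have mono: "- x r \<le> - x s" if "r \<le> s" "s \<le> T" "e / 2 < x s" for r s
      proof (rule le_of_nonneg_derivative_below[where f = "\<lambda>t. - x t" and f' = "\<lambda>t. - xdot (u t)" and b = "- (e / 2)"])
        show "((\<lambda>t. - x t) has_real_derivative - xdot (u r)) (at r)" for r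
          by (intro derivative_intros D_x)
      qed (use that xdot_le in auto)
      have above: "e / 2 < x s" if "s \<le> t" for s
        using mono[of s t] that \<open>t \<le> T\<close> \<open>\<not> x t < e\<close> \<open>e > 0\<close> by simp
      obtain l where l: "((\<lambda>t. - x t) \<longlongrightarrow> l) at_bot" "-a \<le> l" "\<And>s. s \<le> t \<Longrightarrow> l \<le> - x s"
        by (rule tendsto_at_bot_mono[of t "\<lambda>t. - x t" "-a"])
          (use mono above bounds \<open>t \<le> T\<close> in auto)
      have x: "(x \<longlongrightarrow> - l) at_bot" using tendsto_minus[OF l(1)] by simp
      from limit_at_bot(2)[OF x] show False
        using l(2) l(3)[of t] a_less_1 \<open>\<not> x t < e\<close> \<open>e > 0\<close> by auto
    qed
    then show "\<forall>\<^sub>F t in at_bot. x t < e"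
      by (auto simp: eventually_at_bot_linorder)
  qed
  from limit_at_bot(1)[OF this] show ?thesis by (simp add: FL_def)
qed

text \<open>The three conditions on \<open>x\<close> cover all cases and imply the respective
  limits. Since the three points are distinct, each implication is an equivalence.\<close>

lemma alpha_limit_iff:
  shows "alpha_limit u = {Km} \<longleftrightarrow> (\<exists>t. x t < 0)"
    and "alpha_limit u = {Kp} \<longleftrightarrow> (\<exists>t. a < x t)"
    and "alpha_limit u = {FL} \<longleftrightarrow> (\<forall>t. 0 \<le> x t \<and> x t \<le> a)"
    and "alpha_limit u = {FL} \<or> alpha_limit u = {Km} \<or> alpha_limit u = {Kp}"
proof -
  have "alpha_limit u = {Km}" if "x t < 0" for t
    using alpha_limit_eq_singleton[OF tendsto_Km[OF that]] .
  moreover have "alpha_limit u = {Kp}" if "a < x t" for t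
    using alpha_limit_eq_singleton[OF tendsto_Kp[OF that]] .
  moreover have "alpha_limit u = {FL}" if "\<forall>t. 0 \<le> x t \<and> x t \<le> a"
    using alpha_limit_eq_singleton[OF tendsto_FL] that by simp
  moreover have "Km \<noteq> Kp" "Km \<noteq> FL" "Kp \<noteq> FL"
    by (simp_all add: Km_def Kp_def FL_def)
  ultimately show "alpha_limit u = {Km} \<longleftrightarrow> (\<exists>t. x t < 0)"
    and "alpha_limit u = {Kp} \<longleftrightarrow> (\<exists>t. a < x t)"
    and "alpha_limit u = {FL} \<longleftrightarrow> (\<forall>t. 0 \<le> x t \<and> x t \<le> a)"
    and "alpha_limit u = {FL} \<or> alpha_limit u = {Km} \<or> alpha_limit u = {Kp}"
    by (metis not_less singleton_inject)+
qed

end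

section \<open>Uniqueness of the orbit emanating from FL\<close>

text \<open>Along an orbit emanating from \<open>FL\<close>, the quantity \<open>s = ln (\<Omega>\<^sub>V / \<Omega>\<^sub>p\<^sub>f)\<close> increases from
  \<open>-\<infinity>\<close> to \<open>\<infinity>\<close> and can serve as time. With \<open>F\<close> an antiderivative of \<open>(g - a z) / (1 - z\<^sup>2)\<close>,
  the derivative of \<open>F (x)\<close> with respect to \<open>s\<close> is decreasing in \<open>x\<close>, so that two such orbits
  cannot separate as \<open>s\<close> increases from \<open>-\<infinity>\<close>.\<close>

context cosmology
begin

definition F :: "real \<Rightarrow> real"
  where "F z = g / 2 * (ln (1 + z) - ln (1 - z)) + a / 2 * (ln (1 + z) + ln (1 - z))"

lemma D_F:
  assumes "-1 < z" "z < 1"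
  shows "(F has_real_derivative (g - a * z) / (1 - z\<^sup>2)) (at z)"
proof -
  have nz: "1 + z \<noteq> 0" "1 - z \<noteq> 0" using assms by auto
  have "(F has_real_derivative
      g / 2 * (1 / (1 + z) - (- 1) / (1 - z)) + a / 2 * (1 / (1 + z) + (- 1) / (1 - z))) (at z)"
    unfolding F_def[abs_def] using assms by (auto intro!: derivative_eq_intros)
  also have "g / 2 * (1 / (1 + z) - (- 1) / (1 - z)) + a / 2 * (1 / (1 + z) + (- 1) / (1 - z))
      = (g - a * z) / ((1 + z) * (1 - z))"
    using nz by (simp add: divide_simps) (simp add: algebra_simps)?
  also have "(1 + z) * (1 - z) = 1 - z\<^sup>2" by (simp add: algebra_simps power2_eq_square)
  finally show ?thesis .
qed

lemma F_less:
  assumes "0 \<le> z" "z < w" "w < 1" "a * w < g"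
  shows "F z < F w"
proof (rule DERIV_pos_imp_increasing[OF \<open>z < w\<close>])
  fix r assume r: "z \<le> r" "r \<le> w"
  have "a * r < g" using mult_left_mono[OF r(2) a_nonneg] assms by linarith
  moreover have "r\<^sup>2 < 1" using r assms by (simp add: abs_square_less_1)
  ultimately show "\<exists>d. (F has_real_derivative d) (at r) \<and> 0 < d"
    using r assms by (intro exI[of _ "(g - a * r) / (1 - r\<^sup>2)"] conjI D_F) auto
qed

text \<open>The orbit equation for \<open>x\<close> as a function of \<open>s = ln (V / y)\<close>.
  It is stated for \<open>F (X s)\<close> because the derivative of \<open>F\<close> cancels the
  factors \<open>g - a * x\<close> and \<open>1 - x^2\<close> that arise from \<open>x'\<close>
  divided by \<open>s'\<close>; the bound \<open>a * X s < g\<close> keeps \<open>F\<close> strictly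
  increasing.\<close>

definition FL_profile :: "(real \<Rightarrow> real) \<Rightarrow> bool" where
  "FL_profile X \<longleftrightarrow> (\<forall>s. 0 \<le> X s \<and> X s < 1 \<and> a * X s < g) \<and> (X \<longlongrightarrow> 0) at_bot \<and>
    (\<forall>s. ((\<lambda>s. F (X s)) has_real_derivative
      ((a - X s) * exp s - (1 - g) * X s) / (2 * (1 + exp s))) (at s))"

text \<open>The squared difference of \<open>F (X r)\<close> and \<open>F (Y r)\<close> tends to 0
  as \<open>r\<close> tends to minus infinity, and it is nonincreasing: the right-hand sides differ
  by a nonnegative multiple of \<open>Y r - X r\<close>, while \<open>F\<close> is increasing. Hence
  it vanishes.\<close>

lemma FL_profile_unique:
  assumes X: "FL_profile X" and Y: "FL_profile Y"
  shows "X = Y"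
proof
  fix s
  define D where "D r = (F (X r) - F (Y r))\<^sup>2" for r
  let ?h = "\<lambda>X r. ((a - X r) * exp r - (1 - g) * X r) / (2 * (1 + exp r)) :: real"
  have D: "(D has_real_derivative 2 * ((F (X r) - F (Y r)) * (?h X r - ?h Y r))) (at r)" for r
  proof -
    have "((\<lambda>s. F (X s)) has_real_derivative ?h X r) (at r)"
      "((\<lambda>s. F (Y s)) has_real_derivative ?h Y r) (at r)"
      using X Y unfolding FL_profile_def by blast+
    moreover have "real 2 * (p * q ^ (2 - Suc 0)) = 2 * (q * p)" for p q :: real
      by simp
    ultimately show ?thesis
      unfolding D_def[abs_def] by (rule DERIV_cong[OF DERIV_power[OF DERIV_diff]])
  qed
  have less: "F (X r) < F (Y r)" if "X r < Y r" for r
    using X Y that by (intro F_less) (auto simp: FL_profile_def)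
  have greater: "F (Y r) < F (X r)" if "Y r < X r" for r
    using X Y that by (intro F_less) (auto simp: FL_profile_def)
  have D_nonpos: "2 * ((F (X r) - F (Y r)) * (?h X r - ?h Y r)) \<le> 0" for r
  proof -
    have "?h X r - ?h Y r = ((exp r + (1 - g)) / (2 * (1 + exp r))) * (Y r - X r)"
      by (simp add: diff_divide_distrib[symmetric] algebra_simps)
    then have "(F (X r) - F (Y r)) * (?h X r - ?h Y r)
        = ((exp r + (1 - g)) / (2 * (1 + exp r))) * ((F (X r) - F (Y r)) * (Y r - X r))"
      by (simp only: mult.left_commute)
    moreover have "(exp r + (1 - g)) / (2 * (1 + exp r)) \<ge> 0"
      using g_less_1 by (simp add: add_nonneg_nonneg)
    moreover have "(F (X r) - F (Y r)) * (Y r - X r) \<le> 0"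
      using less[of r] greater[of r]
      by (cases "X r" "Y r" rule: linorder_cases) (auto intro: mult_nonpos_nonneg mult_nonneg_nonpos)
    ultimately show ?thesis by (simp only: mult_nonneg_nonpos zero_le_numeral)
  qed
  have D_anti: "D s \<le> D r" if "r \<le> s" for r
  proof (rule DERIV_nonpos_imp_nonincreasing[of r s D])
    show "\<exists>d. (D has_real_derivative d) (at q) \<and> d \<le> 0" for q
      using D[of q] D_nonpos[of q] by (intro exI conjI)
  qed (rule that)
  have "((\<lambda>r. F (X r)) \<longlongrightarrow> F 0) at_bot" "((\<lambda>r. F (Y r)) \<longlongrightarrow> F 0) at_bot"
    using X Y D_F[of 0] isCont_tendsto_compose[OF DERIV_isCont, of F _ 0]
    unfolding FL_profile_def by force+
  then have "(D \<longlongrightarrow> (F 0 - F 0)\<^sup>2) at_bot"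
    unfolding D_def[abs_def] by (intro tendsto_intros)
  then have "D s \<le> (F 0 - F 0)\<^sup>2"
    by (rule tendsto_lowerbound) (use D_anti in \<open>auto simp: eventually_at_bot_linorder\<close>)
  then have "F (X s) = F (Y s)" by (simp add: D_def)
  then show "X s = Y s"
    using less[of s] greater[of s] by (cases "X s" "Y s" rule: linorder_cases) auto
qed

end

context interior_orbit
begin

section \<open>The variable ln (V / y) as time along an orbit from FL\<close>

definition tau :: "real \<Rightarrow> real" where "tau t = ln (V t) - ln (y t)"

lemma D_tau: "(tau has_real_derivative 6 * (g - a * x t)) (at t)"
proof -
  have "(tau has_real_derivative
      6 * V t * ((x t)\<^sup>2 + g * y t - a * x t) / V t - 6 * y t * ((1 - g) * (x t)\<^sup>2 - g * V t) / y t) (at t)"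
    unfolding tau_def[abs_def] using V_pos[of t] y_pos[of t]
    by (auto intro!: derivative_eq_intros D_V D_y)
  also have "6 * V t * ((x t)\<^sup>2 + g * y t - a * x t) / V t - 6 * y t * ((1 - g) * (x t)\<^sup>2 - g * V t) / y t
     = 6 * (((x t)\<^sup>2 + g * y t - a * x t) - ((1 - g) * (x t)\<^sup>2 - g * V t))"
    using V_pos[of t] y_pos[of t] by simp
  also have "\<dots> = 6 * (g - a * x t)" by (simp add: V_eq algebra_simps)
  finally show ?thesis .
qed

lemma V_y_eq:
  shows "y t = (1 - (x t)\<^sup>2) / (1 + exp (tau t))"
    and "V t = (1 - (x t)\<^sup>2) * exp (tau t) / (1 + exp (tau t))"
proof -
  have "exp (tau t) = V t / y t"
    unfolding tau_def using V_pos[of t] y_pos[of t] by (simp add: exp_diff)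
  then have V: "V t = y t * exp (tau t)" using y_pos[of t] by simp
  have "1 - (x t)\<^sup>2 = V t + y t" by (simp add: V_eq)
  then have *: "1 - (x t)\<^sup>2 = y t * (1 + exp (tau t))" using V by (simp add: algebra_simps)
  have nz: "1 + exp (tau t) \<noteq> 0" using exp_gt_zero[of "tau t"] by linarith
  show "y t = (1 - (x t)\<^sup>2) / (1 + exp (tau t))"
    unfolding * using nz by simp
  show "V t = (1 - (x t)\<^sup>2) * exp (tau t) / (1 + exp (tau t))"
    unfolding * V using nz by simp
qed

text \<open>Along such an orbit \<open>a * x < g\<close>, so \<open>tau\<close> increases strictly,
  and its limits make it a bijection of the line; \<open>X\<close> is \<open>x\<close> composed with
  its inverse. The equality of ranges then reduces uniqueness of the orbit to uniqueness of the
  profile.\<close>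

lemma FL_orbit_profile:
  assumes "alpha_limit u = {FL}"
  obtains X where "FL_profile X" "range u = range (\<lambda>s. (X s, (1 - (X s)\<^sup>2) / (1 + exp s)))"
proof -
  have bounds: "0 \<le> x t" "x t \<le> a" for t
    using assms alpha_limit_iff(3) by auto
  have ax: "a * x t < g" for t
  proof (cases "a = 0")
    case False
    then have "a > 0" using a_nonneg by simp
    \<comment> \<open>Where \<open>x = a > 0\<close> the derivative is negative, so \<open>x\<close>
      would exceed \<open>a\<close> just before. This strictness gives \<open>a * x < g\<close> even
      when \<open>g = a^2\<close>.\<close>
    have "x t \<noteq> a"
    proof
      assume "x t = a"
      then have "xdot (u t) < 0" using xdot_neg[of t] \<open>a > 0\<close> by simp
      from DERIV_neg_dec_left[OF D_x this] obtain d
        where d: "d > 0" "\<And>h. h > 0 \<Longrightarrow> h < d \<Longrightarrow> x t < x (t - h)" by auto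
      then have "x t < x (t - d / 2)" by simp
      then show False using bounds(2)[of "t - d / 2"] \<open>x t = a\<close> by simp
    qed
    then have "x t < a" using bounds(2)[of t] by simp
    then have "a * x t < a * a" using \<open>a > 0\<close> by simp
    then show ?thesis using a_sq_le_g by (simp add: power2_eq_square)
  qed (use g_pos in simp)
  have mono: "tau s < tau t" if "s < t" for s t
    by (rule DERIV_pos_imp_increasing[OF that])
      (use D_tau ax in \<open>metis diff_gt_0_iff_gt zero_less_mult_iff zero_less_numeral\<close>)
  have xy: "(x \<longlongrightarrow> 0) at_bot" "(y \<longlongrightarrow> 1) at_bot"
    using tendsto_fst[OF tendsto_FL[OF bounds]] tendsto_snd[OF tendsto_FL[OF bounds]]
    by (simp_all add: FL_def)
  have "filterlim V (at_right 0) at_bot"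
    using V_at_bot V_pos by (simp add: tendsto_imp_filterlim_at_right)
  from filterlim_compose[OF ln_at_0 this] have *: "filterlim (\<lambda>t. - ln (V t)) at_top at_bot"
    by (simp add: filterlim_uminus_at_bot)
  have "filterlim (\<lambda>t. ln (y t) + - ln (V t)) at_top at_bot"
    by (rule filterlim_tendsto_add_at_top[OF tendsto_ln[OF xy(2)] *]) simp
  then have bot: "filterlim tau at_bot at_bot"
    by (simp add: tau_def[abs_def] filterlim_uminus_at_bot)
  have "filterlim y (at_right 0) at_top"
    using tendsto_P_at_top(2) y_pos by (simp add: tendsto_imp_filterlim_at_right)
  from filterlim_compose[OF ln_at_0 this] have *: "filterlim (\<lambda>t. - ln (y t)) at_top at_top"
    by (simp add: filterlim_uminus_at_bot)
  have "((\<lambda>t. 1 - (x t)\<^sup>2 - y t) \<longlongrightarrow> 1 - a\<^sup>2 - 0) at_top"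
    by (intro tendsto_intros tendsto_P_at_top)
  then have V: "(V \<longlongrightarrow> 1 - a\<^sup>2) at_top" by (simp add: V_eq)
  have "filterlim (\<lambda>t. ln (V t) + - ln (y t)) at_top at_top"
    by (rule filterlim_tendsto_add_at_top[OF tendsto_ln[OF V] *]) (use a_sq_le_g g_less_1 in auto)
  then have top: "filterlim tau at_top at_top" by (simp add: tau_def[abs_def])
  have cont: "isCont tau t" for t using D_tau by (rule DERIV_isCont)
  have "\<exists>t. tau t = s" for s
  proof -
    obtain t1 where t1: "tau t1 \<le> s"
      using bot unfolding filterlim_at_bot eventually_at_bot_linorder by blast
    obtain t2 where t2: "s \<le> tau t2"
      using top unfolding filterlim_at_top eventually_at_top_linorder by blast
    have "t1 \<le> t2" using mono[of t2 t1] t1 t2 by linarith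
    then show ?thesis using IVT[of tau t1 s t2] t1 t2 cont by blast
  qed
  then obtain T where T: "\<And>s. tau (T s) = s" by metis
  have T_tau: "T (tau t) = t" for t
    using mono[of t "T (tau t)"] mono[of "T (tau t)" t] T[of "tau t"]
    by (cases t "T (tau t)" rule: linorder_cases) auto
  have "isCont T (tau t)" for t
    by (rule isCont_inverse_function[where d = 1]) (use T_tau cont in auto)
  then have T_cont: "isCont T s" for s by (metis T)
  have D_T: "(T has_real_derivative inverse (6 * (g - a * x (T s)))) (at s)" for s
    by (rule DERIV_inverse_function[where f = tau and a = "s - 1" and b = "s + 1"])
      (use ax[of "T s"] T T_cont D_tau in auto)
  have T_bot: "filterlim T at_bot at_bot"
    unfolding filterlim_at_bot eventually_at_bot_linorder
  proof
    fix Z show "\<exists>N. \<forall>s\<le>N. T s \<le> Z"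
      using mono[of Z] T by (intro exI[of _ "tau Z"]) (metis not_le)
  qed
  define X where "X s = x (T s)" for s
  have "((\<lambda>s. F (X s)) has_real_derivative
      ((a - X s) * exp s - (1 - g) * X s) / (2 * (1 + exp s))) (at s)" for s
  proof -
    have cancel1: "c / d * (e * inverse (6 * c)) = e / (6 * d)" if "c \<noteq> 0" for c d e :: real
      using that by (simp add: divide_simps)
    have cancel2: "3 * (p * (q * e / n) - h * z * (q / n)) = q * (3 * (p * e - h * z) / n)"
      for p q e n h z :: real
      by (simp add: algebra_simps diff_divide_distrib)
    have cancel3: "q * (3 * e / n) / (6 * q) = e / (2 * n)" if "q \<noteq> 0" for q e n :: real
      using that by simp
    have "((\<lambda>s. F (X s)) has_real_derivative
        (g - a * X s) / (1 - (X s)\<^sup>2) * (xdot (u (T s)) * inverse (6 * (g - a * x (T s))))) (at s)"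
      unfolding X_def
      by (intro DERIV_chain2[OF D_F] DERIV_chain2[OF D_x D_T] x_bounds)
    also have "(g - a * X s) / (1 - (X s)\<^sup>2) * (xdot (u (T s)) * inverse (6 * (g - a * x (T s))))
        = xdot (u (T s)) / (6 * (1 - (X s)\<^sup>2))"
      unfolding X_def using ax[of "T s"] by (intro cancel1) simp
    also have "xdot (u (T s)) = (1 - (X s)\<^sup>2) * (3 * ((a - X s) * exp s - (1 - g) * X s) / (1 + exp s))"
      unfolding xdot_def V_y_eq[of "T s"] T X_def by (rule cancel2)
    also have "\<dots> / (6 * (1 - (X s)\<^sup>2)) = ((a - X s) * exp s - (1 - g) * X s) / (2 * (1 + exp s))"
      unfolding X_def using x_sq_less_1[of "T s"] by (intro cancel3) simp
    finally show ?thesis .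
  qed
  moreover have "(X \<longlongrightarrow> 0) at_bot"
    unfolding X_def by (rule filterlim_compose[OF xy(1) T_bot])
  ultimately have "FL_profile X"
    using bounds ax x_bounds by (simp add: FL_profile_def X_def)
  moreover have "range u = range (\<lambda>s. (X s, (1 - (X s)\<^sup>2) / (1 + exp s)))"
  proof -
    have "(X s, (1 - (X s)\<^sup>2) / (1 + exp s)) = u (T s)" for s
      by (simp add: prod_eq_iff X_def V_y_eq(1)[of "T s"] T)
    then have "(\<lambda>s. (X s, (1 - (X s)\<^sup>2) / (1 + exp s))) = (\<lambda>s. u (T s))" by simp
    moreover have "range (\<lambda>s. u (T s)) = range u"
    proof (rule equalityI; rule subsetI)
      fix p assume "p \<in> range u"
      then obtain t where "p = u (T (tau t))" using T_tau by auto
      then show "p \<in> range (\<lambda>s. u (T s))" by blast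
    qed auto
    ultimately show ?thesis by (simp only:)
  qed
  ultimately show ?thesis using that by blast
qed

end

context cosmology
begin

lemma FL_orbit_unique:
  assumes "interior_solution lam gam u" "alpha_limit u = {FL}"
    and "interior_solution lam gam v" "alpha_limit v = {FL}"
  shows "range u = range v"
proof -
  interpret u: interior_orbit lam gam u by unfold_locales fact
  interpret v: interior_orbit lam gam v by unfold_locales fact
  obtain X where X: "FL_profile X" "range u = range (\<lambda>s. (X s, (1 - (X s)\<^sup>2) / (1 + exp s)))"
    by (rule u.FL_orbit_profile[OF assms(2)])
  obtain Y where Y: "FL_profile Y" "range v = range (\<lambda>s. (Y s, (1 - (Y s)\<^sup>2) / (1 + exp s)))"
    by (rule v.FL_orbit_profile[OF assms(4)])
  show ?thesis using FL_profile_unique[OF X(1) Y(1)] X(2) Y(2) by simp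
qed

section \<open>Existence of the orbit emanating from FL\<close>

text \<open>The coordinates \<open>x = tanh w\<close>, \<open>\<Omega>\<^sub>p\<^sub>f / \<Omega>\<^sub>V = exp (2 z)\<close> identify the interior with the plane
  and turn the vector field into a globally Lipschitz one, so that all orbits are complete.\<close>

definition to_state :: "real \<times> real \<Rightarrow> real \<times> real"
  where "to_state p = (tanh (fst p), (1 - (tanh (fst p))\<^sup>2) * (1 + tanh (snd p)) / 2)"

definition wz_field :: "real \<times> real \<Rightarrow> real \<times> real"
  where "wz_field p =
    (3 / 2 * ((a - tanh (fst p)) * (1 - tanh (snd p)) - (1 - g) * tanh (fst p) * (1 + tanh (snd p))),
     3 * (a * tanh (fst p) - g))"

text \<open>The field is a polynomial in two \<open>tanh\<close> terms, each bounded by 1 and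
  1-Lipschitz; the only product that occurs is therefore 2-Lipschitz.\<close>

lemma wz_field_lipschitz: "\<exists>L>0. L-lipschitz_on UNIV wz_field"
proof -
  have tanh_bound: "\<bar>tanh r\<bar> \<le> 1" for r :: real
    using tanh_real_bounds[of r] by auto
  have tanh: "\<bar>tanh r - tanh s\<bar> \<le> \<bar>r - s\<bar>" for r s :: real
  proof -
    have "1-lipschitz_on UNIV (tanh :: real \<Rightarrow> real)"
    proof (rule bounded_derivative_imp_lipschitz)
      show "(tanh has_derivative (*) (1 - (tanh r)\<^sup>2)) (at r within UNIV)" for r :: real
        using has_field_derivative_tanh[OF _ DERIV_ident, of r] by (simp add: has_field_derivative_def)
      show "onorm ((*) (1 - (tanh r)\<^sup>2)) \<le> 1" for r :: real
      proof (rule onorm_le)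
        have "(tanh r)\<^sup>2 \<le> 1" using tanh_bound[of r] by (simp add: abs_square_le_1)
        then have "\<bar>1 - (tanh r)\<^sup>2\<bar> \<le> 1" by simp
        then show "norm ((1 - (tanh r)\<^sup>2) * s) \<le> 1 * norm s" for s
          unfolding real_norm_def abs_mult by (rule mult_right_mono) simp
      qed
    qed auto
    from lipschitz_onD[OF this, of r s] show ?thesis by (simp add: dist_real_def)
  qed
  let ?A = "\<lambda>p::real \<times> real. tanh (fst p)" and ?Z = "\<lambda>p::real \<times> real. tanh (snd p)"
  have A: "\<bar>?A p - ?A q\<bar> \<le> dist p q" for p q
    using tanh[of "fst p" "fst q"] dist_fst_le[of p q] by (simp add: dist_real_def)
  have Z: "\<bar>?Z p - ?Z q\<bar> \<le> dist p q" for p q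
    using tanh[of "snd p" "snd q"] dist_snd_le[of p q] by (simp add: dist_real_def)
  have AZ: "\<bar>?A p * ?Z p - ?A q * ?Z q\<bar> \<le> 2 * dist p q" for p q
  proof -
    have "?A p * ?Z p - ?A q * ?Z q = ?A p * (?Z p - ?Z q) + (?A p - ?A q) * ?Z q"
      by (simp add: algebra_simps)
    also have "\<bar>\<dots>\<bar> \<le> \<bar>?A p\<bar> * \<bar>?Z p - ?Z q\<bar> + \<bar>?A p - ?A q\<bar> * \<bar>?Z q\<bar>"
      by (simp only: abs_mult[symmetric] abs_triangle_ineq)
    also have "\<dots> \<le> 1 * dist p q + dist p q * 1"
      by (intro add_mono mult_mono tanh_bound A Z) auto
    finally show ?thesis by simp
  qed
  have lips: "1-lipschitz_on UNIV ?A" "1-lipschitz_on UNIV ?Z" "2-lipschitz_on UNIV (\<lambda>p. ?A p * ?Z p)"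
    using A Z AZ by (auto intro!: lipschitz_onI simp: dist_real_def)
  have fst_eq: "(a - ?A p) * (1 - ?Z p) - (1 - g) * ?A p * (1 + ?Z p)
      = a + (- a) * ?Z p + (g - 2) * ?A p + g * (?A p * ?Z p)" for p
    by (simp add: algebra_simps)
  have snd_eq: "3 * (a * ?A p - g) = 3 * a * ?A p + - (3 * g)" for p
    by (simp add: algebra_simps)
  have "\<exists>L. L-lipschitz_on UNIV wz_field"
    unfolding wz_field_def[abs_def] fst_eq snd_eq
    by (rule exI) (rule lips lipschitz_on_Pair lipschitz_on_cmult_real lipschitz_on_add lipschitz_on_constant)+
  then obtain L where L: "L-lipschitz_on UNIV wz_field" by blast
  then have "(\<bar>L\<bar> + 1)-lipschitz_on UNIV wz_field"
    by (rule lipschitz_on_mono) auto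
  then show ?thesis by (intro exI[of _ "\<bar>L\<bar> + 1"]) auto
qed

text \<open>The first component of \<open>wz_field\<close> is \<open>x' / (1 - x^2)\<close>. The
  second is \<open>- tau' / 2\<close>, since \<open>y / V = exp (2 * z)\<close>.\<close>

lemma interior_solution_to_state:
  assumes U: "\<And>t. (U has_vector_derivative wz_field (U t)) (at t)"
  shows "interior_solution lam gam (\<lambda>t. to_state (U t))"
  unfolding interior_solution_def
proof (intro conjI allI)
  fix t
  let ?A = "tanh (fst (U t))" and ?Z = "tanh (snd (U t))"
  have A: "1 - ?A\<^sup>2 > 0" using tanh_real_bounds[of "fst (U t)"] by (simp add: abs_square_less_1 abs_if)
  have V: "OmegaV (to_state (U t)) = (1 - ?A\<^sup>2) * (1 - ?Z) / 2"
    by (simp add: OmegaV_def to_state_def field_simps)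
  have "OmegaV (to_state (U t)) > 0" "snd (to_state (U t)) > 0"
    unfolding V using A tanh_real_bounds[of "snd (U t)"] by (auto simp: to_state_def)
  then show "to_state (U t) \<in> interior_set" by (simp add: interior_set_def)
  have *: "(U has_derivative (\<lambda>h. h *\<^sub>R wz_field (U t))) (at t)"
    using U by (simp add: has_vector_derivative_def)
  have fst: "((\<lambda>t. fst (U t)) has_real_derivative fst (wz_field (U t))) (at t)"
    unfolding has_field_derivative_def
    by (rule has_derivative_eq_rhs[OF has_derivative_fst[OF *]]) (simp add: fun_eq_iff)
  have snd: "((\<lambda>t. snd (U t)) has_real_derivative snd (wz_field (U t))) (at t)"
    unfolding has_field_derivative_def
    by (rule has_derivative_eq_rhs[OF has_derivative_snd[OF *]]) (simp add: fun_eq_iff)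
  have dA: "((\<lambda>t. tanh (fst (U t))) has_real_derivative (1 - ?A\<^sup>2) * fst (wz_field (U t))) (at t)"
    by (rule has_field_derivative_tanh[OF _ fst]) simp
  have dZ: "((\<lambda>t. tanh (snd (U t))) has_real_derivative (1 - ?Z\<^sup>2) * snd (wz_field (U t))) (at t)"
    by (rule has_field_derivative_tanh[OF _ snd]) simp
  have 1: "((\<lambda>t. fst (to_state (U t))) has_real_derivative fst (vf lam gam (to_state (U t)))) (at t)"
  proof -
    have "(1 - ?A\<^sup>2) * fst (wz_field (U t)) = fst (vf lam gam (to_state (U t)))"
      unfolding vf_eq V by (simp add: wz_field_def to_state_def field_simps)
    then show ?thesis using dA by (simp add: to_state_def)
  qed
  have 2: "((\<lambda>t. snd (to_state (U t))) has_real_derivative snd (vf lam gam (to_state (U t)))) (at t)"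
  proof -
    have "((\<lambda>t. (1 - (p t)\<^sup>2) * (1 + q t) / 2) has_real_derivative
        ((- (2 * p t * p')) * (1 + q t) + (1 - (p t)\<^sup>2) * q') / 2) (at t)"
      if "(p has_real_derivative p') (at t)" "(q has_real_derivative q') (at t)" for p q p' q'
      using that by (auto intro!: derivative_eq_intros)
    from this[OF dA dZ]
    have "((\<lambda>t. (1 - (tanh (fst (U t)))\<^sup>2) * (1 + tanh (snd (U t))) / 2) has_real_derivative
        ((- (2 * ?A * ((1 - ?A\<^sup>2) * fst (wz_field (U t))))) * (1 + ?Z)
          + (1 - ?A\<^sup>2) * ((1 - ?Z\<^sup>2) * snd (wz_field (U t)))) / 2) (at t)" .
    moreover have "((- (2 * ?A * ((1 - ?A\<^sup>2) * fst (wz_field (U t))))) * (1 + ?Z)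
          + (1 - ?A\<^sup>2) * ((1 - ?Z\<^sup>2) * snd (wz_field (U t)))) / 2
        = snd (vf lam gam (to_state (U t)))"
      unfolding vf_eq V by (simp add: wz_field_def to_state_def field_simps power2_eq_square)
    ultimately show ?thesis by (simp add: to_state_def)
  qed
  have "((\<lambda>t. (fst (to_state (U t)), snd (to_state (U t)))) has_vector_derivative
      (fst (vf lam gam (to_state (U t))), snd (vf lam gam (to_state (U t))))) (at t)"
    using 1 2 unfolding has_real_derivative_iff_has_vector_derivative
    by (rule has_vector_derivative_Pair)
  then show "((\<lambda>t. to_state (U t)) has_vector_derivative vf lam gam (to_state (U t))) (at t)"
    by simp
qed

text \<open>Shooting along \<open>z = 0\<close>: the initial values of the orbits coming from \<open>K\<^sub>-\<close> and from \<open>K\<^sub>+\<close> form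
  disjoint nonempty open sets, which cannot cover the line.\<close>

lemma FL_orbit_exists: "\<exists>u. interior_solution lam gam u \<and> alpha_limit u = {FL}"
proof -
  obtain L where L: "L > 0" "L-lipschitz_on UNIV wz_field"
    using wz_field_lipschitz by blast
  have "\<exists>U. U 0 = (w, 0) \<and> (\<forall>t. (U has_vector_derivative wz_field (U t)) (at t))" for w
    using global_solution_exists[OF L(2,1)] .
  then obtain U where U0: "\<And>w. U w 0 = (w, 0)"
    and U: "\<And>w t. (U w has_vector_derivative wz_field (U w t)) (at t)"
    by metis
  have orbit: "interior_orbit lam gam (\<lambda>t. to_state (U w t))" for w
    by unfold_locales (rule interior_solution_to_state[OF U])
  have "(exp (L * \<bar>t\<bar>))-lipschitz_on UNIV (\<lambda>w. U w t)" for t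
    using solution_dist_le[OF L(2) U U] by (intro lipschitz_onI) (auto simp: U0 dist_Pair_Pair)
  then have cont: "continuous_on UNIV (\<lambda>w. U w t)" for t
    by (rule lipschitz_on_continuous_on)
  \<comment> \<open>For each fixed \<open>t\<close> the set of initial values is open by continuity
    in \<open>w\<close>, so the union over all \<open>t\<close> is open without any uniformity in
    time.\<close>
  define S where "S = (\<Union>t. {w. tanh (fst (U w t)) < 0})"
  define R where "R = (\<Union>t. {w. a < tanh (fst (U w t))})"
  have S: "w \<in> S \<longleftrightarrow> alpha_limit (\<lambda>t. to_state (U w t)) = {Km}" for w
    unfolding interior_orbit.alpha_limit_iff(1)[OF orbit] by (simp add: S_def to_state_def)
  have R: "w \<in> R \<longleftrightarrow> alpha_limit (\<lambda>t. to_state (U w t)) = {Kp}" for w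
    unfolding interior_orbit.alpha_limit_iff(2)[OF orbit] by (simp add: R_def to_state_def)
  have "open S" "open R"
    unfolding S_def R_def
    by (intro open_UN ballI open_Collect_less continuous_intros cont; simp)+
  moreover have "S \<inter> R = {}"
    using S R by (auto simp: Km_def Kp_def)
  moreover have "-1 \<in> S"
    unfolding S_def using U0 by (auto intro!: exI[of _ 0])
  moreover have "R \<noteq> {}"
  proof -
    have "\<forall>\<^sub>F w in at_top. a < tanh (w :: real)"
      using tanh_real_at_top a_less_1 by (rule order_tendstoD)
    then obtain w :: real where "a < tanh w"
      using eventually_happens' trivial_limit_at_top_linorder by blast
    then have "w \<in> R" unfolding R_def using U0 by (auto intro!: exI[of _ 0])
    then show ?thesis by blast
  qed
  ultimately have "\<not> UNIV \<subseteq> S \<union> R"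
    using connectedD[OF connected_UNIV, of S R] by auto
  then obtain w where "w \<notin> S" "w \<notin> R" by blast
  then have "alpha_limit (\<lambda>t. to_state (U w t)) = {FL}"
    using S R interior_orbit.alpha_limit_iff(4)[OF orbit, of w] by blast
  then show ?thesis using interior_solution_to_state[OF U] by blast
qed

section \<open>Transversals\<close>

text \<open>The line \<open>x = b\<close> meets the interior in the segment
  \<open>0 < y < 1 - b^2\<close>, which is rescaled to the unit interval. Crossing it exactly once
  gives each orbit exactly one parameter.\<close>

lemma one_param_family_from_line:
  assumes b: "b\<^sup>2 < 1"
    and crossing: "\<And>u. interior_solution lam gam u \<Longrightarrow> alpha_limit u = {K} \<Longrightarrow> \<exists>!t. fst (u t) = b"
    and limit: "\<And>u t. interior_solution lam gam u \<Longrightarrow> fst (u t) = b \<Longrightarrow> alpha_limit u = {K}"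
  shows "one_param_family_from lam gam K"
  unfolding one_param_family_from_def
proof (intro exI[of _ "\<lambda>s. (b, s * (1 - b\<^sup>2))"] conjI allI ballI impI; (elim conjE)?)
  show "continuous_on {0<..<1} (\<lambda>s. (b, s * (1 - b\<^sup>2)))"
    by (intro continuous_intros)
  show "inj_on (\<lambda>s. (b, s * (1 - b\<^sup>2))) {0<..<1}"
    using b by (auto simp: inj_on_def)
  show "(\<lambda>s. (b, s * (1 - b\<^sup>2))) ` {0<..<1} \<subseteq> interior_set"
    using b by (auto simp: interior_set_def OmegaV_def)
  show "alpha_limit u = {K}" if "interior_solution lam gam u" "(b, s * (1 - b\<^sup>2)) \<in> range u" for s u
  proof -
    from that(2) obtain t where "u t = (b, s * (1 - b\<^sup>2))" by (metis rangeE)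
    then show ?thesis using limit[OF that(1), of t] by simp
  qed
  fix u assume u: "interior_solution lam gam u" "alpha_limit u = {K}"
  obtain t where t: "fst (u t) = b" "\<And>r. fst (u r) = b \<Longrightarrow> r = t"
    using crossing[OF u] by blast
  have "u t \<in> interior_set" using u by (simp add: interior_solution_def)
  then have y: "0 < snd (u t)" "snd (u t) < 1 - b\<^sup>2"
    using t(1) by (auto simp: interior_set_def OmegaV_def)
  show "\<exists>!s. s \<in> {0<..<1} \<and> (b, s * (1 - b\<^sup>2)) \<in> range u"
  proof (rule ex1I[of _ "snd (u t) / (1 - b\<^sup>2)"])
    have "(b, snd (u t) / (1 - b\<^sup>2) * (1 - b\<^sup>2)) = u t"
      using b t(1) by (simp add: prod_eq_iff)
    then show "snd (u t) / (1 - b\<^sup>2) \<in> {0<..<1} \<and>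
        (b, snd (u t) / (1 - b\<^sup>2) * (1 - b\<^sup>2)) \<in> range u"
      using y b by auto
    fix s assume "s \<in> {0<..<1} \<and> (b, s * (1 - b\<^sup>2)) \<in> range u"
    then obtain r where r: "u r = (b, s * (1 - b\<^sup>2))" by (metis rangeE)
    then have "r = t" using t(2)[of r] by simp
    then show "s = snd (u t) / (1 - b\<^sup>2)" using r b by simp
  qed
qed

text \<open>The level \<open>- (1 / 2)\<close> lies strictly between the past limit
  \<open>-1\<close> of \<open>x\<close> and its future limit \<open>a \<ge> 0\<close>, so it is
  attained; strict monotonicity of \<open>x\<close> below 0 allows only one crossing.\<close>

lemma one_param_family_Km: "one_param_family_from lam gam Km"
proof (rule one_param_family_from_line[of "- (1 / 2)"])
  fix u assume u: "interior_solution lam gam u"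
  interpret interior_orbit lam gam u by unfold_locales fact
  show "alpha_limit u = {Km}" if "x t = - (1 / 2)" for t
    unfolding alpha_limit_iff(1) using that by (intro exI[of _ t]) simp
  assume "alpha_limit u = {Km}"
  then obtain T where "x T < 0" using alpha_limit_iff(1) by auto
  from tendsto_fst[OF tendsto_Km[OF this]] have "(x \<longlongrightarrow> -1) at_bot"
    by (simp add: Km_def)
  then have ex: "\<exists>t. x t = - (1 / 2)"
    by (rule continuous_attains_between_limits[OF DERIV_isCont[OF D_x] _ tendsto_P_at_top(1)])
      (use a_nonneg in auto)
  have less: "x s < x t" if "s < t" "x t < 0" for s t
  proof (rule DERIV_pos_imp_increasing[OF \<open>s < t\<close>])
    show "\<exists>d. (x has_real_derivative d) (at r) \<and> 0 < d" if "s \<le> r" "r \<le> t" for r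
      using x_mono[OF \<open>r \<le> t\<close> \<open>x t < 0\<close>] \<open>x t < 0\<close> by (intro exI[of _ "xdot (u r)"] conjI D_x xdot_pos) simp
  qed
  have "s = t" if "x s = - (1 / 2)" "x t = - (1 / 2)" for s t
    using less[of s t] less[of t s] that by (cases s t rule: linorder_cases) auto
  with ex show "\<exists>!t. x t = - (1 / 2)" by blast
qed (simp add: power2_eq_square)

text \<open>The level is the midpoint between the future limit \<open>a\<close> and the past limit 1
  of \<open>x\<close>; the intermediate value argument is applied to \<open>- x\<close>.\<close>

lemma one_param_family_Kp: "one_param_family_from lam gam Kp"
proof (rule one_param_family_from_line[of "(1 + a) / 2"])
  let ?b = "(1 + a) / 2"
  have b: "a < ?b" "?b < 1" using a_less_1 by auto
  then show "?b\<^sup>2 < 1" using a_nonneg by (simp add: abs_square_less_1)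
  fix u assume u: "interior_solution lam gam u"
  interpret interior_orbit lam gam u by unfold_locales fact
  show "alpha_limit u = {Kp}" if "x t = ?b" for t
    unfolding alpha_limit_iff(2) using that b by (intro exI[of _ t]) simp
  assume "alpha_limit u = {Kp}"
  then obtain T where "a < x T" using alpha_limit_iff(2) by auto
  from tendsto_fst[OF tendsto_Kp[OF this]] have *: "(x \<longlongrightarrow> 1) at_bot"
    by (simp add: Kp_def)
  have "\<exists>t. - x t = - ?b"
  proof (rule continuous_attains_between_limits)
    show "isCont (\<lambda>t. - x t) t" for t by (intro continuous_intros DERIV_isCont[OF D_x])
    show "((\<lambda>t. - x t) \<longlongrightarrow> - 1) at_bot" by (intro tendsto_intros *)
    show "((\<lambda>t. - x t) \<longlongrightarrow> - a) at_top" by (intro tendsto_intros tendsto_P_at_top)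
  qed (use b in auto)
  then have ex: "\<exists>t. x t = ?b" by simp
  have less: "x t < x s" if "s < t" "a < x t" for s t
  proof (rule DERIV_neg_imp_decreasing[OF \<open>s < t\<close>])
    show "\<exists>d. (x has_real_derivative d) (at r) \<and> d < 0" if "s \<le> r" "r \<le> t" for r
      using x_antimono[OF \<open>r \<le> t\<close> \<open>a < x t\<close>] \<open>a < x t\<close> a_nonneg by (intro exI[of _ "xdot (u r)"] conjI D_x xdot_neg) auto
  qed
  have "s = t" if "x s = ?b" "x t = ?b" for s t
    using less[of s t] less[of t s] that b by (cases s t rule: linorder_cases) auto
  with ex show "\<exists>!t. x t = ?b" by blast
qed

end

theorem theorem1:
  fixes lam gam :: real
  assumes "lam \<ge> 0" and "0 < gam" and "gam < 2" and "gam \<ge> lam\<^sup>2 / 3"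
  shows "(\<forall>u. interior_solution lam gam u \<longrightarrow> omega_limit u = {Ppt lam})
       \<and> (\<exists>!Orb. \<exists>u. interior_solution lam gam u \<and> Orb = range u \<and> alpha_limit u = {FL})
       \<and> (\<forall>u. interior_solution lam gam u \<longrightarrow>
              alpha_limit u = {FL} \<or> alpha_limit u = {Km} \<or> alpha_limit u = {Kp})
       \<and> one_param_family_from lam gam Km \<and> one_param_family_from lam gam Kp"
proof -
  interpret cosmology lam gam by unfold_locales fact+
  have orbit: "interior_orbit lam gam u" if "interior_solution lam gam u" for u
    using that by unfold_locales
  have "\<exists>!Orb. \<exists>u. interior_solution lam gam u \<and> Orb = range u \<and> alpha_limit u = {FL}"
    using FL_orbit_exists FL_orbit_unique by blast
  then show ?thesis
    using interior_orbit.omega_limit_eq[OF orbit] interior_orbit.alpha_limit_iff(4)[OF orbit]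
      one_param_family_Km one_param_family_Kp by blast
qed

end
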